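(* Let $\lambda>\lambda_0$, let $u_1,u_2$ be viscosity solutions of $a(x)u''+H(x,u')=\lambda$ in $\mathbb R$, and let $v_1,v_2$ be viscosity solutions of $a(x)u''+H(x,u')=\lambda_0$ in $\mathbb R$. (a) If $u_i'\ge v_i'$ a.e. on $\mathbb R$ for $i=1,2$, then $u_1-u_2$ is constant on $\mathbb R$. (b) If $u_i'\le v_i'$ a.e. on $\mathbb R$ for $i=1,2$, then $u_1-u_2$ is constant on $\mathbb R$.
   Context: Deterministic setting: $a:\mathbb R\to[0,1]$ with $\sqrt a$ $\kappa$-Lipschitz and (A1$'$): $a\not\equiv0$ and every connected component of $A:=\{a>0\}$ is a bounded interval. $H:\mathbb R\times\mathbb R\to\mathbb R$ in $\mathscr H_{sqc}(\alpha_0,\alpha_1,\gamma,\eta)$, $\gamma>2$, $\eta>0$: (H1) $\alpha_0|p|^\gamma-1/\alpha_0\le H(x,p)\le\alpha_1(|p|^\gamma+1)$, (H2) $|H(x,p)-H(x,q)|\le\alpha_1(|p|+|q|+1)^{\gamma-1}|p-q|$, (H3) $|H(x,p)-H(y,p)|\le\alpha_1(|p|^\gamma+1)|x-y|$, $H(x,\cdot)$ strictly quasiconvex with unique minimizer $\hat p(x)$, $H(x,p_1)-H(x,p_2)\ge\eta|p_1-p_2|$ for $p_1<p_2\le\hat p(x)$, $H(x,p_2)-H(x,p_1)\ge\eta|p_1-p_2|$ for $p_2>p_1\ge\hat p(x)$. Viscosity conventions: supersolution if $a\varphi''+H(x,\varphi')\le\lambda$ for $C^2$ $\varphi$ touching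 from below, subsolution if $\ge\lambda$ touching from above; solutions are continuous. $\lambda_0:=\inf\{\lambda:\ a u''+H(x,u')=\lambda$ admits a continuous viscosity supersolution on $\mathbb R\}$. (Viscosity solutions of these equations are Lipschitz, hence differentiable a.e.) *)

theory Defs
  imports "HOL-Analysis.Analysis"
begin

definition diff_coeff :: "real \<Rightarrow> (real \<Rightarrow> real) \<Rightarrow> bool" where
  "diff_coeff \<kappa> a \<longleftrightarrow>
     (\<forall>x. 0 \<le> a x \<and> a x \<le> 1) \<and>
     \<kappa>-lipschitz_on UNIV (\<lambda>x. sqrt (a x)) \<and>
     (\<exists>x. a x \<noteq> 0) \<and>
     (\<forall>x\<in>{y. a y > 0}. is_interval (connected_component_set {y. a y > 0} x)
                         \<and> bounded (connected_component_set {y. a y > 0} x))"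

definition H_sqc :: "real \<Rightarrow> real \<Rightarrow> real \<Rightarrow> real \<Rightarrow> (real \<Rightarrow> real \<Rightarrow> real) \<Rightarrow> bool" where
  "H_sqc \<alpha>0 \<alpha>1 \<gamma> \<eta> H \<longleftrightarrow>
     0 < \<alpha>0 \<and> 0 < \<alpha>1 \<and>
     (\<forall>x p. \<alpha>0 * \<bar>p\<bar> powr \<gamma> - 1 / \<alpha>0 \<le> H x p \<and> H x p \<le> \<alpha>1 * (\<bar>p\<bar> powr \<gamma> + 1)) \<and>
     (\<forall>x p q. \<bar>H x p - H x q\<bar> \<le> \<alpha>1 * (\<bar>p\<bar> + \<bar>q\<bar> + 1) powr (\<gamma> - 1) * \<bar>p - q\<bar>) \<and>
     (\<forall>x y p. \<bar>H x p - H y p\<bar> \<le> \<alpha>1 * (\<bar>p\<bar> powr \<gamma> + 1) * \<bar>x - y\<bar>) \<and>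
     (\<forall>x p q t. p \<noteq> q \<and> 0 < t \<and> t < 1 \<longrightarrow>
         H x (t * p + (1 - t) * q) < max (H x p) (H x q)) \<and>
     (\<forall>x. \<exists>!ph. (\<forall>p. H x ph \<le> H x p) \<and>
         (\<forall>p1 p2. p1 < p2 \<and> p2 \<le> ph \<longrightarrow> H x p1 - H x p2 \<ge> \<eta> * \<bar>p1 - p2\<bar>) \<and>
         (\<forall>p1 p2. ph \<le> p1 \<and> p1 < p2 \<longrightarrow> H x p2 - H x p1 \<ge> \<eta> * \<bar>p1 - p2\<bar>))"

definition C2_with :: "(real \<Rightarrow> real) \<Rightarrow> (real \<Rightarrow> real) \<Rightarrow> (real \<Rightarrow> real) \<Rightarrow> bool" where
  "C2_with \<phi> \<phi>' \<phi>'' \<longleftrightarrow>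
     (\<forall>x. (\<phi> has_real_derivative \<phi>' x) (at x)) \<and>
     (\<forall>x. (\<phi>' has_real_derivative \<phi>'' x) (at x)) \<and>
     continuous_on UNIV \<phi>''"

text \<open>Viscosity supersolution of a u'' + H(x,u') = lambda on R, with the paper's
  convention: test functions touching from below give a phi'' + H(x,phi') <= lambda.\<close>
definition visc_super :: "(real \<Rightarrow> real) \<Rightarrow> (real \<Rightarrow> real \<Rightarrow> real) \<Rightarrow> real \<Rightarrow> (real \<Rightarrow> real) \<Rightarrow> bool" where
  "visc_super a H lam u \<longleftrightarrow> continuous_on UNIV u \<and>
     (\<forall>\<phi> \<phi>' \<phi>'' x0. C2_with \<phi> \<phi>' \<phi>'' \<and>
        (\<exists>e>0. \<forall>y. \<bar>y - x0\<bar> < e \<longrightarrow> u y - \<phi> y \<ge> u x0 - \<phi> x0) \<longrightarrow>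
        a x0 * \<phi>'' x0 + H x0 (\<phi>' x0) \<le> lam)"

definition visc_sub :: "(real \<Rightarrow> real) \<Rightarrow> (real \<Rightarrow> real \<Rightarrow> real) \<Rightarrow> real \<Rightarrow> (real \<Rightarrow> real) \<Rightarrow> bool" where
  "visc_sub a H lam u \<longleftrightarrow> continuous_on UNIV u \<and>
     (\<forall>\<phi> \<phi>' \<phi>'' x0. C2_with \<phi> \<phi>' \<phi>'' \<and>
        (\<exists>e>0. \<forall>y. \<bar>y - x0\<bar> < e \<longrightarrow> u y - \<phi> y \<le> u x0 - \<phi> x0) \<longrightarrow>
        a x0 * \<phi>'' x0 + H x0 (\<phi>' x0) \<ge> lam)"

definition visc_sol :: "(real \<Rightarrow> real) \<Rightarrow> (real \<Rightarrow> real \<Rightarrow> real) \<Rightarrow> real \<Rightarrow> (real \<Rightarrow> real) \<Rightarrow> bool" where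
  "visc_sol a H lam u \<longleftrightarrow> visc_sub a H lam u \<and> visc_super a H lam u"

definition lambda0 :: "(real \<Rightarrow> real) \<Rightarrow> (real \<Rightarrow> real \<Rightarrow> real) \<Rightarrow> real" where
  "lambda0 a H = Inf {lam. \<exists>u. visc_super a H lam u}"

text \<open>u' >= v' almost everywhere (wherever both derivatives exist; solutions are
  Lipschitz hence differentiable a.e.).\<close>
definition deriv_ge_ae :: "(real \<Rightarrow> real) \<Rightarrow> (real \<Rightarrow> real) \<Rightarrow> bool" where
  "deriv_ge_ae u v \<longleftrightarrow> (AE x in lborel. \<forall>du dv.
      (u has_real_derivative du) (at x) \<and> (v has_real_derivative dv) (at x) \<longrightarrow> du \<ge> dv)"

end

theory Submission
  imports Defs
begin

text \<open>Linear test functions show that \<open>u - q z\<close> has no local minimum (maximum) where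
  \<open>H(z, q) > \<lambda>\<close> (\<open>H(z, q) < \<lambda>\<close>). Since the level sets of a strictly quasiconvex \<open>H(x, \<cdot>)\<close> have
  empty interior, a solution therefore has one-sided derivatives everywhere, with at most countably
  many kinks. At zeros of \<open>a\<close> the one-sided derivatives solve \<open>H(x, p) = \<lambda>\<close>, because \<open>a\<close>
  vanishes quadratically there; the comparison with \<open>v\<^sub>i\<close>, whose derivative solves \<open>H(x, r) = \<lambda>\<^sub>0\<close>,
  selects the larger root, so \<open>u\<^sub>1' = u\<^sub>2'\<close> there. On a component \<open>(l, r)\<close> of \<open>{a > 0}\<close> solutions
  are classical and \<open>w\<^sub>i = u\<^sub>i'\<close> solves \<open>a w' + H(x, w) = \<lambda>\<close>. Near \<open>l\<close> both \<open>w\<^sub>i\<close> are on the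
  increasing branch of \<open>H\<close>, so \<open>(w\<^sub>1 - w\<^sub>2)\<^sup>2\<close> is nonincreasing and tends to \<open>0\<close> at \<open>l\<close>; hence
  \<open>w\<^sub>1 = w\<^sub>2\<close> near \<open>l\<close>, and on \<open>(l, r)\<close> by Gronwall. Part (b) is part (a) for the equation
  reflected at the origin.\<close>

section \<open>Symmetries and quadratic test functions\<close>

text \<open>This family contains every test function that is built below: \<open>C = 0\<close> gives
  lines, \<open>C < 0\<close> and \<open>C > 0\<close> give parabolas opening down or up.\<close>

lemma C2_with_quadratic:
  "C2_with (\<lambda>z. q * z + C * (z - c)\<^sup>2) (\<lambda>z. q + 2 * C * (z - c)) (\<lambda>z. 2 * C)"
  unfolding C2_with_def by (auto intro!: derivative_eq_intros simp: algebra_simps)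

lemma C2_with_uminus:
  assumes "C2_with f f' f''"
  shows "C2_with (\<lambda>x. - f x) (\<lambda>x. - f' x) (\<lambda>x. - f'' x)"
  using assms unfolding C2_with_def by (auto intro!: derivative_intros continuous_on_minus)

lemma C2_with_reflect:
  assumes "C2_with f f' f''"
  shows "C2_with (\<lambda>x. f (- x)) (\<lambda>x. - f' (- x)) (\<lambda>x. f'' (- x))"
proof -
  have f: "(f has_real_derivative f' x) (at x)" and f': "(f' has_real_derivative f'' x) (at x)"
    and c: "continuous_on UNIV f''" for x
    using assms unfolding C2_with_def by auto
  have "((\<lambda>x. f (- x)) has_real_derivative - f' (- x)) (at x)" for x
    using DERIV_mirror[of f "f' (- x)" x] f[of "- x"] by simp
  moreover have "((\<lambda>x. f' (- x)) has_real_derivative - f'' (- x)) (at x)" for x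
    using DERIV_mirror[of f' "f'' (- x)" x] f'[of "- x"] by simp
  then have "((\<lambda>x. - f' (- x)) has_real_derivative f'' (- x)) (at x)" for x
    using DERIV_minus by fastforce
  moreover have "continuous_on UNIV (\<lambda>x. f'' (- x))"
    by (rule continuous_on_compose2[OF c]) (auto intro: continuous_intros)
  ultimately show ?thesis unfolding C2_with_def by auto
qed

lemma visc_superD:
  assumes "visc_super a H lam u" "C2_with \<phi> \<phi>' \<phi>''" "e > 0"
    and "\<And>y. \<bar>y - x0\<bar> < e \<Longrightarrow> u x0 - \<phi> x0 \<le> u y - \<phi> y"
  shows "a x0 * \<phi>'' x0 + H x0 (\<phi>' x0) \<le> lam"
  using assms unfolding visc_super_def by blast

lemma visc_subD:
  assumes "visc_sub a H lam u" "C2_with \<phi> \<phi>' \<phi>''" "e > 0"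
    and "\<And>y. \<bar>y - x0\<bar> < e \<Longrightarrow> u y - \<phi> y \<le> u x0 - \<phi> x0"
  shows "lam \<le> a x0 * \<phi>'' x0 + H x0 (\<phi>' x0)"
  using assms unfolding visc_sub_def by blast

text \<open>Passing to \<open>- u\<close> exchanges touching from above and from below. Estimates
  for supersolutions that assume neither coercivity nor quasiconvexity of \<open>H\<close> thereby
  serve subsolutions as well.\<close>

lemma visc_sub_imp_super_uminus:
  assumes "visc_sub a H lam u"
  shows "visc_super a (\<lambda>x p. - H x (- p)) (- lam) (\<lambda>x. - u x)"
  unfolding visc_super_def
proof (intro conjI allI impI)
  show "continuous_on UNIV (\<lambda>x. - u x)"
    using assms unfolding visc_sub_def by (auto intro: continuous_on_minus)
  fix \<phi> \<phi>' \<phi>'' x0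
  assume A: "C2_with \<phi> \<phi>' \<phi>'' \<and> (\<exists>e>0. \<forall>y. \<bar>y - x0\<bar> < e \<longrightarrow> - u x0 - \<phi> x0 \<le> - u y - \<phi> y)"
  then obtain e where e: "e > 0" "\<And>y. \<bar>y - x0\<bar> < e \<Longrightarrow> - u x0 - \<phi> x0 \<le> - u y - \<phi> y" by blast
  have "a x0 * (- \<phi>'' x0) + H x0 (- \<phi>' x0) \<ge> lam"
    by (rule visc_subD[OF assms C2_with_uminus e(1)]) (use A e(2) in force)+
  then show "a x0 * \<phi>'' x0 + - H x0 (- \<phi>' x0) \<le> - lam" by simp
qed

text \<open>Reflection of the line keeps second derivatives and reverses first ones, hence
  \<open>H (- x) (- p)\<close>. It yields left-hand statements from right-hand ones.\<close>

lemma visc_super_reflect: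
  assumes "visc_super a H lam u"
  shows "visc_super (\<lambda>x. a (- x)) (\<lambda>x p. H (- x) (- p)) lam (\<lambda>x. u (- x))"
  unfolding visc_super_def
proof (intro conjI allI impI)
  show "continuous_on UNIV (\<lambda>x. u (- x))"
    using assms unfolding visc_super_def
    by (auto intro!: continuous_on_compose2[of UNIV u UNIV] continuous_intros)
  fix \<phi> \<phi>' \<phi>'' x0
  assume A: "C2_with \<phi> \<phi>' \<phi>'' \<and> (\<exists>e>0. \<forall>y. \<bar>y - x0\<bar> < e \<longrightarrow> u (- x0) - \<phi> x0 \<le> u (- y) - \<phi> y)"
  then obtain e where e: "e > 0" "\<And>y. \<bar>y - x0\<bar> < e \<Longrightarrow> u (- x0) - \<phi> x0 \<le> u (- y) - \<phi> y" by blast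
  have "u (- x0) - \<phi> (-(-x0)) \<le> u y - \<phi> (- y)" if "\<bar>y -(-x0)\<bar> < e" for y
    using e(2)[of "- y"] that by (simp add: abs_minus_commute add.commute)
  then have "a (- x0) * (\<phi>'' (-(-x0))) + H (- x0) (- \<phi>' (-(-x0))) \<le> lam"
    using visc_superD[OF assms C2_with_reflect e(1), of \<phi> \<phi>' \<phi>'' "- x0"] A by blast
  then show "a (- x0) * \<phi>'' x0 + H (- x0) (- \<phi>' x0) \<le> lam" by simp
qed

lemma visc_sub_reflect:
  assumes "visc_sub a H lam u"
  shows "visc_sub (\<lambda>x. a (- x)) (\<lambda>x p. H (- x) (- p)) lam (\<lambda>x. u (- x))"
  unfolding visc_sub_def
proof (intro conjI allI impI)
  show "continuous_on UNIV (\<lambda>x. u (- x))"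
    using assms unfolding visc_sub_def
    by (auto intro!: continuous_on_compose2[of UNIV u UNIV] continuous_intros)
  fix \<phi> \<phi>' \<phi>'' x0
  assume A: "C2_with \<phi> \<phi>' \<phi>'' \<and> (\<exists>e>0. \<forall>y. \<bar>y - x0\<bar> < e \<longrightarrow> u (- y) - \<phi> y \<le> u (- x0) - \<phi> x0)"
  then obtain e where e: "e > 0" "\<And>y. \<bar>y - x0\<bar> < e \<Longrightarrow> u (- y) - \<phi> y \<le> u (- x0) - \<phi> x0" by blast
  have "u y - \<phi> (- y) \<le> u (- x0) - \<phi> (-(-x0))" if "\<bar>y -(-x0)\<bar> < e" for y
    using e(2)[of "- y"] that by (simp add: abs_minus_commute add.commute)
  then have "a (- x0) * (\<phi>'' (-(-x0))) + H (- x0) (- \<phi>' (-(-x0))) \<ge> lam"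
    using visc_subD[OF assms C2_with_reflect e(1), of \<phi> \<phi>' \<phi>'' "- x0"] A by blast
  then show "a (- x0) * \<phi>'' x0 + H (- x0) (- \<phi>' x0) \<ge> lam" by simp
qed

lemma visc_sol_reflect:
  assumes "visc_sol a H lam u"
  shows "visc_sol (\<lambda>x. a (- x)) (\<lambda>x p. H (- x) (- p)) lam (\<lambda>x. u (- x))"
  using assms visc_super_reflect visc_sub_reflect unfolding visc_sol_def by blast

lemma visc_super_quadratic_test:
  assumes "visc_super a H lam u" "s < m" "m < t"
    and "\<And>y. s < y \<Longrightarrow> y < t \<Longrightarrow>
      u m - (q * m + C * (m - c)\<^sup>2) \<le> u y - (q * y + C * (y - c)\<^sup>2)"
  shows "a m * (2 * C) + H m (q + 2 * C * (m - c)) \<le> lam"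
  by (rule visc_superD[OF assms(1) C2_with_quadratic, of "min (m - s) (t - m)"]) (use assms in auto)

text \<open>This produces touching points. If a minimiser sits at an endpoint, \<open>g z\<close> is
  no larger than the minimum, so \<open>z\<close> itself is an interior minimiser.\<close>

lemma interior_minimum_if_valley:
  fixes g :: "real \<Rightarrow> real"
  assumes "continuous_on {x..y} g" "x < z" "z < y" "g z \<le> g x" "g z \<le> g y"
  obtains m where "x < m" "m < y" "\<And>w. x \<le> w \<Longrightarrow> w \<le> y \<Longrightarrow> g m \<le> g w"
proof -
  obtain m where m: "m \<in> {x..y}" "\<And>w. w \<in> {x..y} \<Longrightarrow> g m \<le> g w"
    using continuous_attains_inf[of "{x..y}" g] assms by fastforce
  show thesis
  proof (cases "m = x \<or> m = y")
    case True
    then have "g z \<le> g w" if "x \<le> w" "w \<le> y" for w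
      using m(2)[of w] that assms(4,5) by auto
    then show thesis using that assms(2,3) by blast
  next
    case False
    then show thesis using that[of m] m by auto
  qed
qed

text \<open>At an interior minimum of \<open>u z - q * z\<close> a line of slope \<open>q\<close>
  touches \<open>u\<close> from below, which forces \<open>H m q \<le> lam\<close> there.\<close>

lemma visc_super_no_valley:
  assumes "visc_super a H lam u" "x < z" "z < y" "\<And>m. x < m \<Longrightarrow> m < y \<Longrightarrow> lam < H m q"
  shows "min (u x - q * x) (u y - q * y) < u z - q * z"
proof (rule ccontr)
  assume "\<not> ?thesis"
  then have "u z - q * z \<le> u x - q * x" "u z - q * z \<le> u y - q * y" by auto
  moreover have "continuous_on {x..y} (\<lambda>z. u z - q * z)"
    using assms(1) unfolding visc_super_def
    by (auto intro!: continuous_intros intro: continuous_on_subset)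
  ultimately obtain m where m: "x < m" "m < y"
    "\<And>w. x \<le> w \<Longrightarrow> w \<le> y \<Longrightarrow> u m - q * m \<le> u w - q * w"
    using interior_minimum_if_valley[of x y "\<lambda>z. u z - q * z" z] assms(2,3) by blast
  have "a m * (2 * 0) + H m (q + 2 * 0 * (m - 0)) \<le> lam"
    by (rule visc_super_quadratic_test[OF assms(1) m(1,2)]) (use m(3) in auto)
  with assms(4)[OF m(1,2)] show False by simp
qed

lemma visc_sub_no_peak:
  assumes "visc_sub a H lam u" "x < z" "z < y" "\<And>m. x < m \<Longrightarrow> m < y \<Longrightarrow> H m q < lam"
  shows "u z - q * z < max (u x - q * x) (u y - q * y)"
  using visc_super_no_valley[OF visc_sub_imp_super_uminus[OF assms(1)] assms(2,3), of "- q"] assms(4)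
  by (auto simp: min_def max_def split: if_splits)

section \<open>One-sided derivatives\<close>

lemma right_derivative_slopes:
  assumes "(u has_real_derivative p) (at_right x)" "e > 0"
  obtains d where "d > 0"
    "\<And>y. x < y \<Longrightarrow> y < x + d \<Longrightarrow> (p - e) * (y - x) \<le> u y - u x \<and> u y - u x \<le> (p + e) * (y - x)"
proof -
  have "eventually (\<lambda>y. dist ((u y - u x) / (y - x)) p < e) (at_right x)"
    using assms tendstoD unfolding has_field_derivative_iff by blast
  then obtain b where b: "b > x" "\<And>y. x < y \<Longrightarrow> y < b \<Longrightarrow> \<bar>(u y - u x) / (y - x) - p\<bar> < e"
    unfolding eventually_at_right_field dist_real_def by blast
  show thesis
  proof
    show "b - x > 0" using b by simp
    fix y assume y: "x < y" "y < x + (b - x)"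
    with b(2)[of y] have "p - e < (u y - u x) / (y - x)" "(u y - u x) / (y - x) < p + e"
      by (auto simp: abs_less_iff)
    then show "(p - e) * (y - x) \<le> u y - u x \<and> u y - u x \<le> (p + e) * (y - x)"
      using y by (simp add: field_simps)
  qed
qed

lemma has_real_derivative_at_left_iff:
  "(u has_real_derivative p) (at_left x) \<longleftrightarrow>
   ((\<lambda>y. u (- y)) has_real_derivative - p) (at_right (- x))"
proof -
  have "(u (- y) - u x) / (- y - x) = - ((u (- y) - u (-(-x))) / (y -(-x)))" for y
    using minus_divide_right[of "u (- y) - u x" "y + x"] by simp
  then have "(\<lambda>y. (u (- y) - u x) / (- y - x)) = (\<lambda>y. - ((u (- y) - u (-(-x))) / (y -(-x))))"
    by (rule ext)
  then have "(u has_real_derivative p) (at_left x) \<longleftrightarrow>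
    ((\<lambda>y. - ((u (- y) - u (-(-x))) / (y -(-x)))) \<longlongrightarrow> p) (at_right (- x))"
    unfolding has_field_derivative_iff filterlim_at_left_to_right by (simp only:)
  also have "\<dots> \<longleftrightarrow> ((\<lambda>y. u (- y)) has_real_derivative - p) (at_right (- x))"
    unfolding has_field_derivative_iff by (rule tendsto_minus_cancel_left[symmetric])
  finally show ?thesis .
qed

lemma left_derivative_slopes:
  assumes "(u has_real_derivative p) (at_left x)" "e > 0"
  obtains d where "d > 0"
    "\<And>y. x - d < y \<Longrightarrow> y < x \<Longrightarrow> (p - e) * (x - y) \<le> u x - u y \<and> u x - u y \<le> (p + e) * (x - y)"
proof -
  obtain d where d: "d > 0" "\<And>y. - x < y \<Longrightarrow> y < - x + d \<Longrightarrow>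
      (- p - e) * (y -(-x)) \<le> u (- y) - u (-(-x)) \<and> u (- y) - u (-(-x)) \<le> (- p + e) * (y -(-x))"
    using right_derivative_slopes[OF assms(1)[unfolded has_real_derivative_at_left_iff] assms(2)] by blast
  show thesis
  proof
    fix y assume "x - d < y" "y < x"
    then show "(p - e) * (x - y) \<le> u x - u y \<and> u x - u y \<le> (p + e) * (x - y)"
      using d(2)[of "- y"] by (auto simp: algebra_simps)
  qed (rule d(1))
qed

section \<open>Countability of kinks\<close>

text \<open>Sort the minima by a radius \<open>1 / real (Suc n)\<close> on which they are strict.
  Two points of one class closer than this radius would each have the smaller value, so
  \<open>x\<close> is determined within its class by the integer part of
  \<open>real (Suc n) * x\<close>.\<close>

lemma countable_strict_local_minima:
  fixes g :: "real \<Rightarrow> real"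
  shows "countable {x. \<exists>d>0. \<forall>y. y \<noteq> x \<and> \<bar>y - x\<bar> < d \<longrightarrow> g x < g y}"
proof -
  define S where "S n = {x. \<forall>y. y \<noteq> x \<and> \<bar>y - x\<bar> < 1 / real (Suc n) \<longrightarrow> g x < g y}" for n
  have "inj_on (\<lambda>x. \<lfloor>real (Suc n) * x\<rfloor>) (S n)" for n
  proof (rule inj_onI, rule ccontr)
    fix x y assume xy: "x \<in> S n" "y \<in> S n" "\<lfloor>real (Suc n) * x\<rfloor> = \<lfloor>real (Suc n) * y\<rfloor>" "x \<noteq> y"
    then have "\<bar>real (Suc n) * x - real (Suc n) * y\<bar> < 1" by linarith
    then have "real (Suc n) * \<bar>x - y\<bar> < 1" by (simp add: abs_mult flip: right_diff_distrib)
    then have "\<bar>x - y\<bar> < 1 / real (Suc n)" by (simp add: field_simps)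
    then show False using xy unfolding S_def by (smt (verit) mem_Collect_eq)
  qed
  then have "countable (S n)" for n
    by (rule countable_image_inj_on[rotated]) auto
  then have "countable (\<Union>n. S n)" by simp
  moreover have "{x. \<exists>d>0. \<forall>y. y \<noteq> x \<and> \<bar>y - x\<bar> < d \<longrightarrow> g x < g y} \<subseteq> (\<Union>n. S n)"
  proof safe
    fix x d :: real assume d: "d > 0" "\<forall>y. y \<noteq> x \<and> \<bar>y - x\<bar> < d \<longrightarrow> g x < g y"
    obtain n where n: "1 / real (Suc n) < d" using d(1) nat_approx_posE by blast
    then have "x \<in> S n" unfolding S_def using d(2) order.strict_trans[OF _ n] by blast
    then show "x \<in> (\<Union>n. S n)" by blast
  qed
  ultimately show ?thesis by (rule countable_subset[rotated])
qed

text \<open>A rational \<open>q\<close> strictly between the two one-sided derivatives makes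
  \<open>x\<close> a strict local minimum of \<open>u x - q * x\<close>; there are countably many
  such \<open>q\<close>, and countably many minima for each.\<close>

lemma countable_convex_kinks:
  fixes u :: "real \<Rightarrow> real"
  shows "countable {x. \<exists>r p. (u has_real_derivative r) (at_left x) \<and>
    (u has_real_derivative p) (at_right x) \<and> r < p}" (is "countable ?K")
proof -
  define M where "M q = {x. \<exists>d>0. \<forall>y. y \<noteq> x \<and> \<bar>y - x\<bar> < d \<longrightarrow> u x - q * x < u y - q * y}" for q
  have "?K \<subseteq> (\<Union>q\<in>\<rat>. M q)"
  proof safe
    fix x r p assume r: "(u has_real_derivative r) (at_left x)"
      and p: "(u has_real_derivative p) (at_right x)" and "r < p"
    then obtain q where q: "q \<in> \<rat>" "r < q" "q < p" using Rats_dense_in_real by blast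
    then have pos: "(p - q) / 2 > 0" "(q - r) / 2 > 0" by auto
    obtain d1 where d1: "d1 > 0" "\<And>y. x < y \<Longrightarrow> y < x + d1 \<Longrightarrow> (p - (p - q) / 2) * (y - x) \<le> u y - u x"
      using right_derivative_slopes[OF p pos(1)] by metis
    obtain d2 where d2: "d2 > 0" "\<And>y. x - d2 < y \<Longrightarrow> y < x \<Longrightarrow> u x - u y \<le> (r + (q - r) / 2) * (x - y)"
      using left_derivative_slopes[OF r pos(2)] by metis
    have "u x - q * x < u y - q * y" if "y \<noteq> x" "\<bar>y - x\<bar> < min d1 d2" for y
    proof (cases "y < x")
      case True
      have "0 < (q - r) / 2 * (x - y)" using True q by simp
      with d2(2)[of y] True that show ?thesis by (simp add: algebra_simps) argo
    next
      case False
      then have "0 < (p - q) / 2 * (y - x)" using that q by simp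
      with d1(2)[of y] False that show ?thesis by (simp add: algebra_simps) argo
    qed
    then have "x \<in> M q" unfolding M_def using d1(1) d2(1) by (auto intro!: exI[of _ "min d1 d2"])
    then show "x \<in> (\<Union>q\<in>\<rat>. M q)" using q by blast
  qed
  moreover have "countable (\<Union>q\<in>\<rat>. M q)"
    unfolding M_def by (intro countable_UN countable_rat countable_strict_local_minima)
  ultimately show ?thesis by (rule countable_subset)
qed

lemma has_real_derivative_at_iff_sides:
  "(u has_real_derivative p) (at x) \<longleftrightarrow>
   (u has_real_derivative p) (at_left x) \<and> (u has_real_derivative p) (at_right x)" for x :: real
  unfolding has_field_derivative_iff by (rule filterlim_at_split)

lemma countable_kinks:
  fixes u :: "real \<Rightarrow> real"
  assumes "\<And>x. \<exists>p. (u has_real_derivative p) (at_left x)"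
    and "\<And>x. \<exists>p. (u has_real_derivative p) (at_right x)"
  shows "countable {x. \<not> (\<exists>p. (u has_real_derivative p) (at x))}"
proof (rule countable_subset[OF _ countable_Un[OF countable_convex_kinks[of u]
      countable_convex_kinks[of "\<lambda>x. - u x"]]], rule subsetI)
  fix x assume n: "x \<in> {x. \<not> (\<exists>p. (u has_real_derivative p) (at x))}"
  obtain r p where r: "(u has_real_derivative r) (at_left x)" and p: "(u has_real_derivative p) (at_right x)"
    using assms by blast
  have "r \<noteq> p" using n r p has_real_derivative_at_iff_sides by blast
  then consider "r < p" | "- r < - p" by linarith
  then show "x \<in> {x. \<exists>r p. (u has_real_derivative r) (at_left x) \<and>
        (u has_real_derivative p) (at_right x) \<and> r < p} \<union>
      {x. \<exists>r p. ((\<lambda>x. - u x) has_real_derivative r) (at_left x) \<and>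
        ((\<lambda>x. - u x) has_real_derivative p) (at_right x) \<and> r < p}"
    by cases (use r p DERIV_minus[OF r] DERIV_minus[OF p] in blast)+
qed

lemma continuous_pair_nbhd:
  fixes H :: "real \<Rightarrow> real \<Rightarrow> real"
  assumes "continuous_on UNIV (\<lambda>(x, p). H x p)" "c < H x p"
  obtains e where "e > 0" "\<And>z q. \<bar>z - x\<bar> < e \<Longrightarrow> \<bar>q - p\<bar> < e \<Longrightarrow> c < H z q"
proof -
  have op: "open {w. c < (case w of (x, p) \<Rightarrow> H x p)}" (is "open ?S")
    by (rule open_Collect_less) (use assms in auto)
  have mem: "(x, p) \<in> ?S" using assms(2) by simp
  obtain A B where AB: "open A" "open B" "(x, p) \<in> A \<times> B" "A \<times> B \<subseteq> ?S"
    using open_prod_elim[OF op mem] by blast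
  obtain e1 where e1: "e1 > 0" "\<And>z. \<bar>z - x\<bar> < e1 \<Longrightarrow> z \<in> A"
    using AB(1,3) unfolding open_dist dist_real_def by blast
  obtain e2 where e2: "e2 > 0" "\<And>q. \<bar>q - p\<bar> < e2 \<Longrightarrow> q \<in> B"
    using AB(2,3) unfolding open_dist dist_real_def by blast
  show thesis
  proof
    fix z q assume "\<bar>z - x\<bar> < min e1 e2" "\<bar>q - p\<bar> < min e1 e2"
    then have "(z, q) \<in> A \<times> B" using e1(2) e2(2) by simp
    from subsetD[OF AB(4) this] show "c < H z q" by simp
  qed (use e1(1) e2(1) in simp)
qed

section \<open>Touching parabolas at zeros of the coefficient and at kinks\<close>

text \<open>Subtract from \<open>u\<close> a concave parabola that leaves \<open>x0\<close> with
  slope slightly above \<open>p\<close>. The difference first dips and then rises, so it has a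
  minimum just right of \<open>x0\<close>. There the slope of the parabola is still close to
  \<open>p\<close>, and the quadratic bound on \<open>a\<close> makes the second-order term smaller
  than \<open>s\<close>.\<close>

lemma visc_super_right_derivative_at_zero:
  assumes u: "visc_super a H lam u" and H: "continuous_on UNIV (\<lambda>(x, p). H x p)"
    and a: "\<And>x. a x \<le> K * (x - x0)\<^sup>2" and K: "K \<ge> 0"
    and p: "(u has_real_derivative p) (at_right x0)"
  shows "H x0 p \<le> lam"
proof (rule ccontr)
  assume neg: "\<not> H x0 p \<le> lam"
  define s where "s = (H x0 p - lam) / 2"
  have s: "s > 0" "lam + s < H x0 p" using neg unfolding s_def by (auto simp: field_simps)
  obtain e where e: "e > 0" "\<And>z q. \<bar>z - x0\<bar> < e \<Longrightarrow> \<bar>q - p\<bar> < e \<Longrightarrow> lam + s < H z q"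
    using continuous_pair_nbhd[OF H s(2)] by blast
  then have "e / 8 > 0" by simp
  then obtain d where d: "d > 0" "\<And>y. x0 < y \<Longrightarrow> y < x0 + d \<Longrightarrow>
      (p - e / 8) * (y - x0) \<le> u y - u x0 \<and> u y - u x0 \<le> (p + e / 8) * (y - x0)"
    using right_derivative_slopes[OF p] by blast
  define D where "D = min d e / 2"
  have D: "D > 0" "D < d" "D < e" using d e unfolding D_def by auto
  define q where "q = p + e / 4"
  \<comment> \<open>The first summand gives \<open>C * D \<ge> e / 2\<close>, so that
    \<open>h\<close> has risen back by \<open>x0 + D\<close>; the second gives
    \<open>2 * K * e\<^sup>2 < C * s\<close>, which beats the second-order term.\<close>
  define C where "C = e / (2 * D) + 2 * K * e\<^sup>2 / s"
  have C1: "C * D \<ge> e / 2" and C0: "C > 0"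
    using D e(1) s(1) K unfolding C_def by (auto simp: distrib_right intro!: add_pos_nonneg)
  have "2 * K * e\<^sup>2 = 2 * K * e\<^sup>2 / s * s" using s by simp
  also have "\<dots> < C * s" unfolding C_def using D e(1) s(1) by (intro mult_strict_right_mono) auto
  finally have C2: "2 * K * e\<^sup>2 < C * s" .
  define h where "h z = u z - (q * z + (- C) * (z - x0)\<^sup>2)" for z
  have hd: "h z - h x0 = (u z - u x0) - q * (z - x0) + C * (z - x0) * (z - x0)" for z
    unfolding h_def by (simp add: algebra_simps power2_eq_square)
  have h_ub: "h z - h x0 \<le> (z - x0) * (C * (z - x0) - e / 8)" if "x0 < z" "z < x0 + d" for z
  proof -
    have "h z - h x0 \<le> (p + e / 8) * (z - x0) - q * (z - x0) + C * (z - x0) * (z - x0)"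
      using d(2)[OF that] unfolding hd by linarith
    also have "\<dots> = (z - x0) * (C * (z - x0) - e / 8)" unfolding q_def by (simp add: field_simps)
    finally show ?thesis .
  qed
  have h_lb: "(z - x0) * (C * (z - x0) - 3 * e / 8) \<le> h z - h x0" if "x0 < z" "z < x0 + d" for z
  proof -
    have "(z - x0) * (C * (z - x0) - 3 * e / 8) =
        (p - e / 8) * (z - x0) - q * (z - x0) + C * (z - x0) * (z - x0)"
      unfolding q_def by (simp add: field_simps)
    also have "\<dots> \<le> h z - h x0" using d(2)[OF that] unfolding hd by linarith
    finally show ?thesis .
  qed
  \<comment> \<open>The bound \<open>h_ub\<close> vanishes at distance \<open>e / (8 * C)\<close>
    from \<open>x0\<close>, so \<open>h\<close> is no larger there than at \<open>x0\<close>; at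
    distance \<open>D\<close> the bound \<open>h_lb\<close> is nonnegative.\<close>
  have z: "e / (8 * C) < D" "e / (8 * C) > 0" using C1 C0 e(1) by (auto simp: field_simps)
  have 1: "h (x0 + e / (8 * C)) \<le> h x0" using h_ub[of "x0 + e / (8 * C)"] z D(2) C0 by simp
  have "0 \<le> D * (C * D - 3 * e / 8)" using D C1 e(1) by (intro mult_nonneg_nonneg) auto
  then have 2: "h x0 \<le> h (x0 + D)" using h_lb[of "x0 + D"] D by simp
  have "continuous_on {x0..x0 + D} h" unfolding h_def
    using u unfolding visc_super_def by (auto intro!: continuous_intros intro: continuous_on_subset)
  then obtain m where m: "x0 < m" "m < x0 + D" "\<And>w. x0 \<le> w \<Longrightarrow> w \<le> x0 + D \<Longrightarrow> h m \<le> h w"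
    by (rule interior_minimum_if_valley[of x0 "x0 + D" h "x0 + e / (8 * C)"]) (use z 1 2 in auto)
  \<comment> \<open>Comparing \<open>h m\<close> with \<open>h x0\<close> localises \<open>m\<close>
    at scale \<open>e / C\<close>, hence the slope of the parabola at \<open>m\<close> differs from
    \<open>p\<close> by less than \<open>e\<close>.\<close>
  have "(m - x0) * (C * (m - x0) - 3 * e / 8) \<le> 0"
    using h_lb[of m] m(1,2) m(3)[of x0] D by linarith
  then have Cs: "C * (m - x0) \<le> 3 * e / 8" using m(1) by (simp add: mult_le_0_iff)
  have "a m * (2 * (- C)) + H m (q + 2 * (- C) * (m - x0)) \<le> lam"
    by (rule visc_super_quadratic_test[OF u m(1,2)]) (use m(3) in \<open>auto simp: h_def\<close>)
  moreover have "lam + s < H m (q + 2 * (- C) * (m - x0))"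
  proof (rule e(2))
    show "\<bar>m - x0\<bar> < e" using m D by auto
    have "C * (m - x0) > 0" using C0 m by simp
    then show "\<bar>q + 2 * (- C) * (m - x0) - p\<bar> < e" using Cs e(1) unfolding q_def by (auto simp: abs_less_iff)
  qed
  \<comment> \<open>Since \<open>a m \<le> K * (m - x0)\<^sup>2\<close>, the term is at most
    \<open>2 * K * (C * (m - x0))\<^sup>2 / C\<close>, with a bounded numerator and a large
    \<open>C\<close>.\<close>
  moreover have "a m * (2 * C) < s"
  proof -
    have "(C * (m - x0))\<^sup>2 \<le> (3 * e / 8)\<^sup>2" using Cs C0 m(1) by (intro power_mono) auto
    also have "\<dots> \<le> e\<^sup>2" using e(1) by (intro power_mono) auto
    finally have "2 * K * (C * (m - x0))\<^sup>2 \<le> 2 * K * e\<^sup>2" using K by (intro mult_left_mono) auto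
    moreover have "C * (a m * (2 * C)) \<le> 2 * K * (C * (m - x0))\<^sup>2"
      using mult_left_mono[OF a[of m], of "2 * C * C"] C0 by (simp add: power2_eq_square algebra_simps)
    ultimately have "C * (a m * (2 * C)) < C * s" using C2 by linarith
    then show ?thesis using C0 by simp
  qed
  ultimately show False by simp
qed

text \<open>A convex corner can be touched from below by parabolas of arbitrarily large curvature;
  as \<open>a x > 0\<close>, the second-order term then exceeds any bound.\<close>

lemma visc_super_no_convex_kink:
  assumes u: "visc_super a H lam u" and a: "a x > 0"
    and r: "(u has_real_derivative r) (at_left x)" and p: "(u has_real_derivative p) (at_right x)"
  shows "p \<le> r"
proof (rule ccontr)
  assume "\<not> p \<le> r"
  define e q where "e = (p - r) / 4" and "q = (p + r) / 2"
  have e: "e > 0" and pq: "p = q + 2 * e" and rq: "r = q - 2 * e"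
    using \<open>\<not> p \<le> r\<close> unfolding e_def q_def by (auto simp: field_simps)
  define C where "C = (\<bar>lam - H x q\<bar> + 1) / a x"
  have C: "C > 0" using a unfolding C_def by simp
  obtain d1 where d1: "d1 > 0" "\<And>y. x < y \<Longrightarrow> y < x + d1 \<Longrightarrow> (p - e) * (y - x) \<le> u y - u x"
    using right_derivative_slopes[OF p e] by metis
  obtain d2 where d2: "d2 > 0" "\<And>y. x - d2 < y \<Longrightarrow> y < x \<Longrightarrow> u x - u y \<le> (r + e) * (x - y)"
    using left_derivative_slopes[OF r e] by metis
  \<comment> \<open>Within distance \<open>e / C\<close> the parabola rises above its tangent by at
    most \<open>e * \<bar>y - x\<bar>\<close>, which is exactly the slack left between
    \<open>q\<close> and the slopes \<open>p - e\<close> and \<open>r + e\<close>.\<close>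
  define d where "d = min (min d1 d2) (e / C)"
  have d: "d > 0" using d1 d2 e C unfolding d_def by simp
  have "a x * (2 * C) + H x (q + 2 * C * (x - x)) \<le> lam"
  proof (rule visc_super_quadratic_test[OF u, of "x - d" x "x + d"])
    fix y assume y: "x - d < y" "y < x + d"
    have key: "C * (y - x)\<^sup>2 \<le> e * \<bar>y - x\<bar>"
    proof -
      have "\<bar>y - x\<bar> \<le> e / C" using y unfolding d_def by auto
      then have "C * \<bar>y - x\<bar> \<le> e" using C by (simp add: field_simps)
      then have "C * \<bar>y - x\<bar> * \<bar>y - x\<bar> \<le> e * \<bar>y - x\<bar>" by (rule mult_right_mono) simp
      then show ?thesis by (simp add: power2_eq_square mult.assoc)
    qed
    consider "y = x" | "x < y" | "y < x" by linarith
    then show "u x - (q * x + C * (x - x)\<^sup>2) \<le> u y - (q * y + C * (y - x)\<^sup>2)"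
    proof cases
      case 2
      with y have "y < x + d1" unfolding d_def by simp
      from d1(2)[OF 2 this] key 2 show ?thesis by (simp add: pq algebra_simps)
    next
      case 3
      with y have "x - d2 < y" unfolding d_def by simp
      from d2(2)[OF this 3] key 3 show ?thesis by (simp add: rq algebra_simps)
    qed simp
  qed (use d in auto)
  moreover have "a x * C = \<bar>lam - H x q\<bar> + 1" unfolding C_def using a by simp
  ultimately show False by (simp add: algebra_simps)
qed

section \<open>Functions without peaks or without valleys\<close>

definition no_peak :: "(real \<Rightarrow> real) \<Rightarrow> real \<Rightarrow> real \<Rightarrow> bool" where
  "no_peak g s t \<longleftrightarrow> (\<forall>x y z. s \<le> x \<and> x < y \<and> y < z \<and> z \<le> t \<longrightarrow> g y < max (g x) (g z))"

text \<open>Both alternatives are kept because the sign of \<open>H x q - lam\<close> decides which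
  one holds for \<open>u z - q * z\<close> near \<open>x\<close>: subsolutions exclude peaks if it
  is negative, supersolutions exclude valleys if it is positive.\<close>

definition unimodal :: "(real \<Rightarrow> real) \<Rightarrow> real \<Rightarrow> real \<Rightarrow> bool" where
  "unimodal g s t \<longleftrightarrow> no_peak g s t \<or> no_peak (\<lambda>x. - g x) s t"

lemma no_peakD: "no_peak g s t \<Longrightarrow> s \<le> x \<Longrightarrow> x < y \<Longrightarrow> y < z \<Longrightarrow> z \<le> t \<Longrightarrow> g y < max (g x) (g z)"
  unfolding no_peak_def by blast

lemma no_peak_minusD:
  "no_peak (\<lambda>x. - g x) s t \<Longrightarrow> s \<le> x \<Longrightarrow> x < y \<Longrightarrow> y < z \<Longrightarrow> z \<le> t \<Longrightarrow> min (g x) (g z) < g y"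
  using no_peakD[of "\<lambda>x. - g x" s t x y z] by (auto simp: min_def max_def split: if_splits)

lemma unimodal_uminus: "unimodal (\<lambda>x. - g x) s t \<longleftrightarrow> unimodal g s t"
  unfolding unimodal_def by auto

text \<open>Without peaks, one return of \<open>g\<close> to the level \<open>g x\<close> or below
  at \<open>y\<close> keeps \<open>g\<close> under that level on all of \<open>(x, y)\<close>.
  Applied to \<open>u z - q * z\<close>, this decides on which side of \<open>q\<close> the chord
  slopes from \<open>x\<close> lie.\<close>

lemma unimodal_right_dichotomy:
  assumes "unimodal g x (x + e)" "e > 0"
  shows "(\<exists>d>0. \<forall>y. x < y \<and> y < x + d \<longrightarrow> g x \<le> g y) \<or> (\<exists>d>0. \<forall>y. x < y \<and> y < x + d \<longrightarrow> g y \<le> g x)"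
proof -
  have *: "(\<exists>d>0. \<forall>y. x < y \<and> y < x + d \<longrightarrow> g x \<le> g y) \<or> (\<exists>d>0. \<forall>y. x < y \<and> y < x + d \<longrightarrow> g y \<le> g x)"
    if n: "no_peak g x (x + e)" for g
  proof (cases "\<exists>y. x < y \<and> y < x + e \<and> g y \<le> g x")
    case True
    then obtain y where y: "x < y" "y < x + e" "g y \<le> g x" by blast
    have "g z \<le> g x" if "x < z" "z < x + (y - x)" for z
      using no_peakD[OF n, of x z y] that y by auto
    then show ?thesis using y(1) by (intro disjI2 exI[of _ "y - x"]) auto
  next
    case False
    then show ?thesis using assms(2) by (intro disjI1 exI[of _ e]) force
  qed
  from assms(1) show ?thesis
    unfolding unimodal_def
  proof
    assume "no_peak (\<lambda>x. - g x) x (x + e)"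
    from *[OF this] show ?thesis by auto
  qed (rule *)
qed

text \<open>Without peaks, \<open>g x < g y\<close> leaves only \<open>g y < g z\<close> for a later
  \<open>z\<close>. Without valleys, \<open>g\<close> increases up to a maximiser \<open>m\<close>
  over a closed right neighbourhood, and \<open>m\<close> differs from \<open>x\<close> by
  \<open>inc\<close>.\<close>

lemma unimodal_right_increasing:
  assumes g: "unimodal g x (x + e)" "e > 0" "continuous_on UNIV g"
    and inc: "\<And>z. x < z \<Longrightarrow> z < x + e \<Longrightarrow> g x < g z"
  shows "\<exists>d>0. \<forall>y z. x \<le> y \<and> y < z \<and> z < x + d \<longrightarrow> g y \<le> g z"
  using g(1) unfolding unimodal_def
proof
  assume n: "no_peak g x (x + e)"
  have "g y \<le> g z" if "x \<le> y" "y < z" "z < x + e" for y z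
  proof (cases "y = x")
    case False
    then show ?thesis using no_peakD[OF n, of x y z] inc[of y] that by auto
  qed (use inc[of z] that in auto)
  then show ?thesis using g(2) by blast
next
  assume n: "no_peak (\<lambda>x. - g x) x (x + e)"
  obtain m where m: "m \<in> {x..x + e / 2}" "\<And>z. z \<in> {x..x + e / 2} \<Longrightarrow> g z \<le> g m"
    using continuous_attains_sup[OF compact_Icc _ continuous_on_subset[OF g(3)], of x "x + e / 2"] g(2)
    by (metis atLeastAtMost_iff half_gt_zero le_add_same_cancel1 less_eq_real_def empty_iff subset_UNIV order_refl)
  have "m \<noteq> x" using m(2)[of "x + e / 4"] inc[of "x + e / 4"] g(2) by auto
  have "g y \<le> g z" if "x \<le> y" "y < z" "z < x + (m - x)" for y z
    using no_peak_minusD[OF n, of y z m] m(2)[of z] that m(1) g(2) by auto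
  then show ?thesis using m(1) \<open>m \<noteq> x\<close> by (intro exI[of _ "m - x"]) auto
qed

lemma unimodal_subset: "unimodal g s t \<Longrightarrow> t' \<le> t \<Longrightarrow> unimodal g s t'"
  unfolding unimodal_def no_peak_def by (meson order_trans)

lemma right_derivative_between:
  assumes w: "(u has_real_derivative w) (at_right y)" and "y < b"
    and "\<And>z. y < z \<Longrightarrow> z < b \<Longrightarrow> A * (z - y) \<le> u z - u y \<and> u z - u y \<le> B * (z - y)"
  shows "A \<le> w \<and> w \<le> B"
proof -
  have lim: "((\<lambda>z. (u z - u y) / (z - y)) \<longlongrightarrow> w) (at_right y)"
    using w unfolding has_field_derivative_iff .
  have "\<forall>\<^sub>F z in at_right y. A \<le> (u z - u y) / (z - y)" "\<forall>\<^sub>F z in at_right y. (u z - u y) / (z - y) \<le> B"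
    unfolding eventually_at_right_field using assms(2,3)
    by (auto intro!: exI[of _ b] simp: field_simps)
  then show ?thesis
    using tendsto_lowerbound[OF lim] tendsto_upperbound[OF lim] by auto
qed

text \<open>If \<open>w\<close> grew faster than \<open>k\<close>, some \<open>q\<close> would make
  the derivative of \<open>u\<close> minus the parabola with derivative \<open>q + k * m\<close>
  negative at \<open>y\<close> and positive at \<open>z\<close>. At the resulting interior minimum
  \<open>w m = q + k * m\<close>, and the supersolution inequality contradicts the hypothesis on
  \<open>k\<close>.\<close>

lemma visc_super_derivative_growth:
  assumes u: "visc_super a H lam u"
    and w: "\<And>z. s < z \<Longrightarrow> z < t \<Longrightarrow> (u has_real_derivative w z) (at z)"
    and k: "\<And>z. s < z \<Longrightarrow> z < t \<Longrightarrow> lam < a z * k + H z (w z)"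
    and yz: "s < y" "y < z" "z < t"
  shows "w z - w y \<le> k * (z - y)"
proof (rule ccontr)
  assume "\<not> ?thesis"
  then have "w y - k * y < w z - k * z" by (simp add: algebra_simps)
  then obtain q where q: "w y - k * y < q" "q < w z - k * z" using dense by blast
  define g where "g m = u m - (q * m + k / 2 * (m - 0)\<^sup>2)" for m
  have g': "(g has_real_derivative w m - (q + k * m)) (at m)" if "s < m" "m < t" for m
    unfolding g_def by (rule derivative_eq_intros w that refl | simp)+
  have "continuous_on {y..z} g" unfolding g_def
    using u unfolding visc_super_def by (auto intro!: continuous_intros intro: continuous_on_subset)
  then obtain m where m: "m \<in> {y..z}" "\<And>x. x \<in> {y..z} \<Longrightarrow> g m \<le> g x"
    using continuous_attains_inf[of "{y..z}" g] yz(2) by auto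
  have "m \<noteq> y"
  proof
    assume "m = y"
    have "w y - (q + k * y) < 0" using q by simp
    then obtain d where d: "d > 0" "\<And>h. h > 0 \<Longrightarrow> h < d \<Longrightarrow> g (y + h) < g y"
      using DERIV_neg_dec_right[OF g'] yz by (metis order.strict_trans)
    define h where "h = min (d / 2) (z - y)"
    have "g (y + h) < g y" "y + h \<in> {y..z}" using d yz unfolding h_def by (auto simp: min_def)
    then show False using m(2)[of "y + h"] \<open>m = y\<close> by simp
  qed
  moreover have "m \<noteq> z"
  proof
    assume "m = z"
    have "0 < w z - (q + k * z)" using q by simp
    then obtain d where d: "d > 0" "\<And>h. h > 0 \<Longrightarrow> h < d \<Longrightarrow> g (z - h) < g z"
      using DERIV_pos_inc_left[OF g'] yz by (metis order.strict_trans)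
    define h where "h = min (d / 2) (z - y)"
    have "g (z - h) < g z" "z - h \<in> {y..z}" using d yz unfolding h_def by (auto simp: min_def)
    then show False using m(2)[of "z - h"] \<open>m = z\<close> by simp
  qed
  ultimately have myz: "y < m" "m < z" using m(1) by auto
  have "a m * (2 * (k / 2)) + H m (q + 2 * (k / 2) * (m - 0)) \<le> lam"
    by (rule visc_super_quadratic_test[OF u myz]) (use m(2) in \<open>auto simp: g_def\<close>)
  moreover have "w m - (q + k * m) = 0"
  proof (rule DERIV_local_min[OF g', of m "min (m - y) (z - m)"])
    show "\<forall>x. \<bar>m - x\<bar> < min (m - y) (z - m) \<longrightarrow> g m \<le> g x"
    proof (intro allI impI)
      fix x assume "\<bar>m - x\<bar> < min (m - y) (z - m)"
      then have "x \<in> {y..z}" by auto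
      then show "g m \<le> g x" by (rule m(2))
    qed
  qed (use myz yz in auto)
  ultimately show False using k[of m] myz yz by simp
qed

section \<open>Regularity of viscosity solutions\<close>

text \<open>The assumptions are stated in a form stable under reflection. \<open>a_quadratic\<close>
  comes from the Lipschitz bound on the square root of \<open>a\<close>; \<open>a_zero_left\<close>
  and \<open>a_zero_right\<close> come from the boundedness of the components of
  \<open>{a > 0}\<close>.\<close>

locale degenerate_equation =
  fixes a :: "real \<Rightarrow> real" and H :: "real \<Rightarrow> real \<Rightarrow> real" and K :: real
  assumes a_cont: "continuous_on UNIV a" and a_nonneg: "\<And>x. a x \<ge> 0"
    and K_nonneg: "K \<ge> 0"
    and a_quadratic: "\<And>x x0. a x0 = 0 \<Longrightarrow> a x \<le> K * (x - x0)\<^sup>2"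
    and a_zero_left: "\<And>x. \<exists>z<x. a z = 0" and a_zero_right: "\<And>x. \<exists>z>x. a z = 0"
    and H_cont: "continuous_on UNIV (\<lambda>(x, p). H x p)"
    and H_coercive: "\<And>c. \<exists>M>0. \<forall>x p. M \<le> \<bar>p\<bar> \<longrightarrow> c < H x p"
    and H_quasiconvex: "\<And>x p q r. p < q \<Longrightarrow> q < r \<Longrightarrow> H x q < max (H x p) (H x r)"
    and H_lipschitz: "\<And>R. \<exists>L. \<forall>x p q. \<bar>p\<bar> \<le> R \<and> \<bar>q\<bar> \<le> R \<longrightarrow> \<bar>H x p - H x q\<bar> \<le> L * \<bar>p - q\<bar>"
begin

lemma reflected: "degenerate_equation (\<lambda>x. a (- x)) (\<lambda>x p. H (- x) (- p)) K"
proof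
  show "continuous_on UNIV (\<lambda>x. a (- x))"
    by (rule continuous_on_compose2[OF a_cont]) (auto intro: continuous_intros)
  have "continuous_on UNIV (\<lambda>w. (\<lambda>(x, p). H x p) (- fst w, - snd w))"
    by (rule continuous_on_compose2[OF H_cont]) (auto intro!: continuous_intros)
  then show "continuous_on UNIV (\<lambda>(x, p). H (- x) (- p))" by (simp add: case_prod_unfold)
  show "a (- x) \<le> K * (x - x0)\<^sup>2" if "a (- x0) = 0" for x x0
    using a_quadratic[OF that, of "- x"] by (simp add: power2_commute)
  show "\<exists>z<x. a (- z) = 0" for x
    using a_zero_right[of "- x"] by (metis minus_less_iff minus_minus)
  show "\<exists>z>x. a (- z) = 0" for x
    using a_zero_left[of "- x"] by (metis less_minus_iff minus_minus)
  show "\<exists>M>0. \<forall>x p. M \<le> \<bar>p\<bar> \<longrightarrow> c < H (- x) (- p)" for c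
    using H_coercive[of c] by (metis abs_minus_cancel)
  show "H (- x) (- q) < max (H (- x) (- p)) (H (- x) (- r))" if "p < q" "q < r" for x p q r
    using H_quasiconvex[of "- r" "- q" "- p" "- x"] that by (simp add: max.commute)
  show "\<exists>L. \<forall>x p q. \<bar>p\<bar> \<le> R \<and> \<bar>q\<bar> \<le> R \<longrightarrow> \<bar>H (- x) (- p) - H (- x) (- q)\<bar> \<le> L * \<bar>p - q\<bar>" for R
  proof -
    obtain L where L: "\<And>x p q. \<bar>p\<bar> \<le> R \<Longrightarrow> \<bar>q\<bar> \<le> R \<Longrightarrow> \<bar>H x p - H x q\<bar> \<le> L * \<bar>p - q\<bar>"
      using H_lipschitz[of R] by blast
    have "\<bar>H (- x) (- p) - H (- x) (- q)\<bar> \<le> L * \<bar>p - q\<bar>" if "\<bar>p\<bar> \<le> R" "\<bar>q\<bar> \<le> R" for x p q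
      using L[of "- p" "- q" "- x"] that by (simp add: abs_minus_commute)
    then show ?thesis by blast
  qed
qed (use a_nonneg K_nonneg in auto)

lemma H_cont_minus: "continuous_on UNIV (\<lambda>(x, p). - H x (- p))"
proof -
  have "continuous_on UNIV (\<lambda>w. - (\<lambda>(x, p). H x p) (fst w, - snd w))"
    by (intro continuous_on_minus continuous_on_compose2[OF H_cont]) (auto intro!: continuous_intros)
  then show ?thesis by (simp add: case_prod_unfold)
qed

lemma H_gt_nbhd:
  assumes "c < H x p"
  obtains e where "e > 0" "\<And>z. \<bar>z - x\<bar> < e \<Longrightarrow> c < H z p"
  using continuous_pair_nbhd[OF H_cont assms] by (metis abs_zero diff_self)

lemma H_lt_nbhd:
  assumes "H x p < c"
  obtains e where "e > 0" "\<And>z. \<bar>z - x\<bar> < e \<Longrightarrow> H z p < c"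
proof -
  have "- c < - H x (- (- p))" using assms by simp
  from continuous_pair_nbhd[OF H_cont_minus this] show thesis
    by (metis abs_zero diff_self minus_minus neg_less_iff_less that)
qed

text \<open>If some chord had a large slope, then to its left all chords would have slopes in a range
  \<open>[M, L]\<close> around a zero \<open>x0\<close> of \<open>a\<close>, and steep parabolas \<open>- C (z - x0)\<^sup>2\<close> touch \<open>u\<close> from below so
  close to \<open>x0\<close> that the second-order term is negligible.\<close>

lemma visc_super_slope_bound:
  assumes u: "visc_super a H lam u"
  obtains M where "M > 0" "\<And>x y. x < y \<Longrightarrow> u y - u x \<le> M * (y - x)"
proof -
  obtain M where M: "M > 0" "\<And>x p. M \<le> \<bar>p\<bar> \<Longrightarrow> lam + 1 < H x p" using H_coercive by blast
  \<comment> \<open>At steep slopes \<open>q\<close> the function \<open>u z - q * z\<close> has no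
    valley; since it rises from \<open>x\<close> to \<open>y\<close>, it cannot fall anywhere before
    \<open>x\<close>.\<close>
  have steep: "q * (w - z) \<le> u w - u z"
    if q: "M \<le> q" and xy: "x < y" "q * (y - x) < u y - u x" and zw: "z < w" "w \<le> x" for q x y z w
  proof (rule ccontr)
    assume neg: "\<not> q * (w - z) \<le> u w - u z"
    have gt: "lam < H m q" for m using M(2)[of q m] M(1) q by linarith
    have wy: "u y - q * y < u w - q * w"
      using visc_super_no_valley[OF u zw(1), of y q] gt neg zw xy by (auto simp: algebra_simps)
    then have "w < x" using zw(2) xy(2) by (cases "w = x") (auto simp: algebra_simps)
    then show False
      using visc_super_no_valley[OF u \<open>w < x\<close> xy(1), of q] gt wy xy(2) by (auto simp: algebra_simps)
  qed
  have "u y - u x \<le> M * (y - x)" if xy: "x < y" for x y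
  proof (rule ccontr)
    assume neg: "\<not> u y - u x \<le> M * (y - x)"
    obtain x0 where x0: "x0 < x" "a x0 = 0" using a_zero_left by blast
    \<comment> \<open>\<open>L\<close> exceeds the slope of the unit chord from
      \<open>x0 - 2\<close> to \<open>x0 - 1\<close>. A steeper chord further right would, by
      \<open>steep\<close>, pass its slope on to this one.\<close>
    define L where "L = max M (u (x0 - 1) - u (x0 - 2) + 1)"
    have L: "M \<le> L" "u (x0 - 1) - u (x0 - 2) < L" unfolding L_def by auto
    have lower: "M * (w - z) \<le> u w - u z" if "z < w" "w \<le> x" for z w
      using steep[of M x y z w] xy neg that by auto
    have upper: "u w - u z \<le> L * (w - z)" if "x0 - 1 \<le> z" "z < w" for z w
      using steep[of L z w "x0 - 2" "x0 - 1"] L that by force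
    \<comment> \<open>The restriction to distance 1 keeps the points in the range of
      \<open>upper\<close>, the other one in the range of \<open>lower\<close>.\<close>
    define d where "d = min 1 (x - x0)"
    have d: "d > 0" "d \<le> 1" "x0 + d \<le> x" unfolding d_def using x0 by auto
    \<comment> \<open>The first summand lets \<open>C * d\<^sup>2\<close> outweigh the drop of
      \<open>u\<close> by at most \<open>L * d\<close> left of \<open>x0\<close>; the second yields
      \<open>2 * C * a m \<le> 1\<close> at the touching point.\<close>
    define C where "C = 2 * L / d + 2 * K * L\<^sup>2"
    have Lp: "L > 0" using L M by simp
    have C: "C > 0" "C * d \<ge> 2 * L" "C \<ge> 2 * K * L\<^sup>2"
      unfolding C_def using Lp d K_nonneg by (auto simp: distrib_right intro!: add_pos_nonneg)
    define h where "h z = u z - (0 * z + (- C) * (z - x0)\<^sup>2)" for z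
    have "continuous_on {x0 - d..x0 + d} h" unfolding h_def
      using u unfolding visc_super_def by (auto intro!: continuous_intros intro: continuous_on_subset)
    moreover have "h x0 \<le> h (x0 - d)"
    proof -
      have "u x0 - u (x0 - d) \<le> L * d" using upper[of "x0 - d" x0] d by simp
      also have "\<dots> \<le> C * d * d" using C(2) d(1) Lp by (intro mult_right_mono) auto
      finally show ?thesis unfolding h_def by (simp add: power2_eq_square)
    qed
    moreover have "h x0 \<le> h (x0 + d)"
    proof -
      have "0 \<le> M * d" "0 \<le> C * d\<^sup>2" using M d C by auto
      then show ?thesis using lower[of x0 "x0 + d"] d unfolding h_def by simp
    qed
    ultimately obtain m where m: "x0 - d < m" "m < x0 + d"
        "\<And>w. x0 - d \<le> w \<Longrightarrow> w \<le> x0 + d \<Longrightarrow> h m \<le> h w"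
      using interior_minimum_if_valley[of "x0 - d" "x0 + d" h x0] d(1) by auto
    have "m \<le> x0"
    proof (rule ccontr)
      assume "\<not> m \<le> x0"
      then have "0 < M * (m - x0)" "0 \<le> C * (m - x0)\<^sup>2" using M C by auto
      then show False using lower[of x0 m] m d \<open>\<not> m \<le> x0\<close> m(3)[of x0] unfolding h_def by simp
    qed
    define s where "s = x0 - m"
    have s: "s \<ge> 0" using \<open>m \<le> x0\<close> unfolding s_def by simp
    have Cs: "C * s \<le> L"
    proof (cases "s = 0")
      case False
      have "u x0 - u m \<le> L * s" using upper[of m x0] m d s False unfolding s_def by simp
      moreover have "C * s * s \<le> u x0 - u m"
        using m(3)[of x0] d unfolding h_def s_def by (simp add: power2_eq_square algebra_simps)
      ultimately have "C * s * s \<le> L * s" by linarith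
      then show ?thesis using s False by simp
    qed (use Lp in simp)
    \<comment> \<open>The parabola has slope \<open>2 * C * s\<close> at \<open>m\<close>. Chords of
      \<open>u\<close> ending at \<open>m\<close> have slope at least \<open>M\<close>, and
      \<open>h m \<le> h (m - t)\<close> passes this to the parabola as \<open>t\<close> tends to
      0.\<close>
    have slope: "M \<le> 2 * C * s"
    proof (rule field_le_epsilon)
      fix e :: real assume e: "e > 0"
      define t where "t = min (m - (x0 - d)) (e / C)"
      have t: "t > 0" "t \<le> m - (x0 - d)" "C * t \<le> e"
        unfolding t_def using m e C by (auto simp: min_def field_simps)
      have "M * t \<le> u m - u (m - t)" using lower[of "m - t" m] t \<open>m \<le> x0\<close> x0 by simp
      also have "\<dots> \<le> C * (s + t)\<^sup>2 - C * s\<^sup>2"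
        using m(3)[of "m - t"] t m unfolding h_def s_def
        by (simp add: power2_eq_square algebra_simps)
      also have "\<dots> = (2 * C * s + C * t) * t" by (simp add: power2_eq_square algebra_simps)
      finally have "M \<le> 2 * C * s + C * t" using t by simp
      then show "M \<le> 2 * C * s + e" using t by simp
    qed
    have "a m * (2 * (- C)) + H m (0 + 2 * (- C) * (m - x0)) \<le> lam"
      by (rule visc_super_quadratic_test[OF u m(1,2)]) (use m(3) in \<open>auto simp: h_def\<close>)
    moreover have "0 + 2 * (- C) * (m - x0) = 2 * C * s" unfolding s_def by (simp add: algebra_simps)
    ultimately have "a m * (2 * (- C)) + H m (2 * C * s) \<le> lam" by metis
    then have "H m (2 * C * s) \<le> lam + 2 * C * a m" by (simp add: algebra_simps)
    moreover have "lam + 1 < H m (2 * C * s)" using M(2) slope by force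
    moreover have "2 * C * a m \<le> 1"
    proof -
      have "C * (2 * C * a m) \<le> 2 * K * (C * s)\<^sup>2"
        using mult_left_mono[OF a_quadratic[OF x0(2), of m], of "2 * C * C"] C
        unfolding s_def by (simp add: power2_eq_square algebra_simps)
      also have "\<dots> \<le> 2 * K * L\<^sup>2"
        using Cs C s K_nonneg by (intro mult_left_mono power_mono) auto
      also have "\<dots> \<le> C * 1" using C by simp
      finally show ?thesis using C(1) by (simp only: mult_le_cancel_left_pos)
    qed
    ultimately show False by simp
  qed
  then show thesis using that M(1) by blast
qed

text \<open>The slope bound is one-sided; its version for the reflected supersolution bounds the
  slopes from below.\<close>

lemma visc_super_quotient_bound:
  assumes u: "visc_super a H lam u"
  obtains M where "\<And>x y. x < y \<Longrightarrow> \<bar>(u y - u x) / (y - x)\<bar> \<le> M"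
proof -
  interpret R: degenerate_equation "\<lambda>x. a (- x)" "\<lambda>x p. H (- x) (- p)" K by (rule reflected)
  obtain M where M: "M > 0" "\<And>x y. x < y \<Longrightarrow> u y - u x \<le> M * (y - x)"
    using visc_super_slope_bound[OF u] by blast
  obtain N where N: "N > 0" "\<And>x y. x < y \<Longrightarrow> u (- y) - u (- x) \<le> N * (y - x)"
    using R.visc_super_slope_bound[OF visc_super_reflect[OF u]] by blast
  show thesis
  proof
    fix x y :: real assume "x < y"
    moreover have "M * (y - x) \<le> max M N * (y - x)" "N * (y - x) \<le> max M N * (y - x)"
      using \<open>x < y\<close> by (auto intro: mult_right_mono)
    moreover have "u x - u y \<le> N * (y - x)" using N(2)[of "- y" "- x"] \<open>x < y\<close> by simp
    ultimately have "\<bar>u y - u x\<bar> \<le> max M N * (y - x)"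
      using M(2)[of x y] by linarith
    then show "\<bar>(u y - u x) / (y - x)\<bar> \<le> max M N" using \<open>x < y\<close> by (simp add: field_simps)
  qed
qed

section \<open>Existence and one-sided continuity of derivatives\<close>

lemma visc_sol_unimodal:
  assumes u: "visc_sol a H lam u" and "H x q \<noteq> lam"
  obtains e where "e > 0" "unimodal (\<lambda>z. u z - q * z) x (x + e)"
proof (cases "H x q < lam")
  case True
  then obtain e where e: "e > 0" "\<And>z. \<bar>z - x\<bar> < e \<Longrightarrow> H z q < lam" using H_lt_nbhd by blast
  have "no_peak (\<lambda>z. u z - q * z) x (x + e)" unfolding no_peak_def
    using u e(2) unfolding visc_sol_def by (auto intro!: visc_sub_no_peak[of a H lam])
  then show thesis using that e(1) unfolding unimodal_def by blast
next
  case False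
  then have "lam < H x q" using assms by simp
  then obtain e where e: "e > 0" "\<And>z. \<bar>z - x\<bar> < e \<Longrightarrow> lam < H z q" using H_gt_nbhd by blast
  have "no_peak (\<lambda>z. - (u z - q * z)) x (x + e)" unfolding no_peak_def
  proof (intro allI impI)
    fix s y z assume A: "x \<le> s \<and> s < y \<and> y < z \<and> z \<le> x + e"
    have "min (u s - q * s) (u z - q * z) < u y - q * y"
      using u e(2) A unfolding visc_sol_def by (intro visc_super_no_valley[of a H lam]) auto
    then show "- (u y - q * y) < max (- (u s - q * s)) (- (u z - q * z))" by linarith
  qed
  then show thesis using that e(1) unfolding unimodal_def by blast
qed

text \<open>Strict quasiconvexity does not allow one value of \<open>H x\<close> at three different
  slopes, so one of three sample points in the interval avoids \<open>lam\<close>.\<close>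

lemma noncritical_slope_between:
  assumes "r < s"
  obtains q where "r < q" "q < s" "H x q \<noteq> lam"
proof -
  define p1 p2 p3 where "p1 = (3 * r + s) / 4" "p2 = (r + s) / 2" "p3 = (r + 3 * s) / 4"
  have o: "r < p1" "p1 < p2" "p2 < p3" "p3 < s" using assms unfolding p1_p2_p3_def by (auto simp: field_simps)
  have "H x p2 < max (H x p1) (H x p3)" using H_quasiconvex o by blast
  then consider "H x p1 \<noteq> lam" | "H x p2 \<noteq> lam" | "H x p3 \<noteq> lam" by fastforce
  then show thesis using that o by (metis order.strict_trans)
qed

text \<open>The lower limit of the difference quotients is also their upper limit: just above it
  lies a noncritical \<open>q\<close>, and the dichotomy for \<open>u z - q * z\<close> puts all
  quotients near \<open>x\<close> at or below \<open>q\<close>.\<close>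

lemma right_derivative_exists:
  assumes u: "visc_sol a H lam u"
  shows "\<exists>p. (u has_real_derivative p) (at_right x)"
proof -
  define Q where "Q y = (u y - u x) / (y - x)" for y
  obtain M where M: "\<And>x y. x < y \<Longrightarrow> \<bar>(u y - u x) / (y - x)\<bar> \<le> M"
    using u visc_super_quotient_bound unfolding visc_sol_def by blast
  \<comment> \<open>\<open>Sup S\<close> is the lower limit of \<open>Q\<close> at \<open>x\<close>,
    finite by the Lipschitz bound \<open>M\<close>.\<close>
  define S where "S = {q. \<forall>\<^sub>F y in at_right x. q \<le> Q y}"
  have gt: "\<forall>\<^sub>F y in at_right x. x < y" by (simp add: eventually_at_right_less)
  have "- M \<in> S" unfolding S_def mem_Collect_eq
    using gt by eventually_elim (use M in \<open>simp add: Q_def abs_le_iff minus_le_iff del: abs_divide\<close>)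
  have ub: "q \<le> M" if "q \<in> S" for q
  proof -
    have "\<forall>\<^sub>F y in at_right x. q \<le> M"
      using gt that[unfolded S_def mem_Collect_eq]
      by eventually_elim (use M[THEN abs_le_D1] order_trans in \<open>unfold Q_def, blast\<close>)
    then show ?thesis by simp
  qed
  then have bdd: "bdd_above S" by (meson bdd_aboveI)
  have "(Q \<longlongrightarrow> Sup S) (at_right x)"
  proof (rule order_tendstoI)
    fix q assume "q < Sup S"
    then obtain q' where q': "q' \<in> S" "q < q'" using less_cSupE \<open>- M \<in> S\<close> by (metis empty_iff)
    then show "\<forall>\<^sub>F y in at_right x. q < Q y"
      unfolding S_def by (auto elim!: eventually_mono)
  next
    fix r assume "Sup S < r"
    then obtain q where q: "Sup S < q" "q < r" "H x q \<noteq> lam" using noncritical_slope_between by blast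
    then have "q \<notin> S" using bdd cSup_upper by (metis linorder_not_less)
    obtain e where e: "e > 0" "unimodal (\<lambda>z. u z - q * z) x (x + e)"
      using visc_sol_unimodal[OF u q(3)] by blast
    have "\<not> (\<exists>d>0. \<forall>y. x < y \<and> y < x + d \<longrightarrow> u x - q * x \<le> u y - q * y)"
    proof
      assume "\<exists>d>0. \<forall>y. x < y \<and> y < x + d \<longrightarrow> u x - q * x \<le> u y - q * y"
      then obtain d where d: "d > 0" "\<And>y. x < y \<Longrightarrow> y < x + d \<Longrightarrow> u x - q * x \<le> u y - q * y" by blast
      have "q \<le> Q y" if "x < y" "y < x + d" for y
        using d(2)[OF that] that unfolding Q_def by (simp add: field_simps)
      then have "q \<in> S" unfolding S_def eventually_at_right_field using d(1)
        by (auto intro!: exI[of _ "x + d"])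
      with \<open>q \<notin> S\<close> show False by simp
    qed
    then obtain d where d: "d > 0" "\<And>y. x < y \<Longrightarrow> y < x + d \<Longrightarrow> u y - q * y \<le> u x - q * x"
      using unimodal_right_dichotomy[OF e(2,1)] by blast
    have "Q y < r" if "x < y" "y < x + d" for y
    proof -
      have "Q y \<le> q" using d(2)[OF that] that unfolding Q_def by (simp add: field_simps)
      then show ?thesis using q(2) by simp
    qed
    then show "\<forall>\<^sub>F y in at_right x. Q y < r" unfolding eventually_at_right_field using d(1)
      by (auto intro!: exI[of _ "x + d"])
  qed
  then show ?thesis unfolding has_field_derivative_iff Q_def by blast
qed

lemma left_derivative_exists:
  assumes u: "visc_sol a H lam u"
  shows "\<exists>p. (u has_real_derivative p) (at_left x)"
proof -
  interpret R: degenerate_equation "\<lambda>x. a (- x)" "\<lambda>x p. H (- x) (- p)" K by (rule reflected)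
  obtain p where "((\<lambda>x. u (- x)) has_real_derivative p) (at_right (- x))"
    using R.right_derivative_exists[OF visc_sol_reflect[OF u]] by blast
  then show ?thesis using has_real_derivative_at_left_iff[of u "- p" x] by auto
qed

text \<open>The slope control holds for all chords near \<open>x\<close>, not only for those
  starting at \<open>x\<close>: with noncritical \<open>q < p < r\<close>, both
  \<open>u z - q * z\<close> and \<open>r * z - u z\<close> increase to the right of
  \<open>x\<close>. Continuity of the derivative follows from this.\<close>

lemma right_slopes:
  assumes u: "visc_sol a H lam u" and p: "(u has_real_derivative p) (at_right x)" and e: "e > 0"
  obtains d where "d > 0" "\<And>y z. x \<le> y \<Longrightarrow> y < z \<Longrightarrow> z < x + d \<Longrightarrow>
    (p - e) * (z - y) \<le> u z - u y \<and> u z - u y \<le> (p + e) * (z - y)"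
proof -
  have cont: "continuous_on UNIV u" using u unfolding visc_sol_def visc_sub_def by blast
  have "p - e < p" "p < p + e" using e by auto
  obtain q where q: "p - e < q" "q < p" "H x q \<noteq> lam" using noncritical_slope_between[OF \<open>p - e < p\<close>] by blast
  obtain r where r: "p < r" "r < p + e" "H x r \<noteq> lam" using noncritical_slope_between[OF \<open>p < p + e\<close>] by blast
  have "\<exists>d>0. \<forall>y z. x \<le> y \<and> y < z \<and> z < x + d \<longrightarrow> u y - q * y \<le> u z - q * z"
  proof -
    obtain e1 where e1: "e1 > 0" "unimodal (\<lambda>z. u z - q * z) x (x + e1)"
      using visc_sol_unimodal[OF u q(3)] by blast
    have "(p - q) / 2 > 0" using q by simp
    then obtain e2 where e2: "e2 > 0" "\<And>y. x < y \<Longrightarrow> y < x + e2 \<Longrightarrow> (p - (p - q) / 2) * (y - x) \<le> u y - u x"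
      using right_derivative_slopes[OF p] by metis
    show ?thesis
    proof (rule unimodal_right_increasing[of _ x "min e1 e2"])
      show "unimodal (\<lambda>z. u z - q * z) x (x + min e1 e2)" by (rule unimodal_subset[OF e1(2)]) auto
      fix z assume z: "x < z" "z < x + min e1 e2"
      have "q * (z - x) < (p - (p - q) / 2) * (z - x)"
        using z q by (intro mult_strict_right_mono) (auto simp: field_simps)
      also have "\<dots> \<le> u z - u x" using e2(2)[of z] z by simp
      finally show "u x - q * x < u z - q * z" by (simp add: algebra_simps)
    qed (use e1 e2 cont in \<open>auto intro!: continuous_intros\<close>)
  qed
  then obtain d1 where d1: "d1 > 0"
    "\<And>y z. x \<le> y \<Longrightarrow> y < z \<Longrightarrow> z < x + d1 \<Longrightarrow> u y - q * y \<le> u z - q * z" by blast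
  have "\<exists>d>0. \<forall>y z. x \<le> y \<and> y < z \<and> z < x + d \<longrightarrow> - (u y - r * y) \<le> - (u z - r * z)"
  proof -
    obtain e1 where e1: "e1 > 0" "unimodal (\<lambda>z. u z - r * z) x (x + e1)"
      using visc_sol_unimodal[OF u r(3)] by blast
    have "(r - p) / 2 > 0" using r by simp
    then obtain e2 where e2: "e2 > 0" "\<And>y. x < y \<Longrightarrow> y < x + e2 \<Longrightarrow> u y - u x \<le> (p + (r - p) / 2) * (y - x)"
      using right_derivative_slopes[OF p] by metis
    show ?thesis
    proof (rule unimodal_right_increasing[of _ x "min e1 e2"])
      show "unimodal (\<lambda>z. - (u z - r * z)) x (x + min e1 e2)"
        unfolding unimodal_uminus by (rule unimodal_subset[OF e1(2)]) auto
      fix z assume z: "x < z" "z < x + min e1 e2"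
      have "u z - u x \<le> (p + (r - p) / 2) * (z - x)" using e2(2)[of z] z by simp
      also have "\<dots> < r * (z - x)"
        using z r by (intro mult_strict_right_mono) (auto simp: field_simps)
      finally show "- (u x - r * x) < - (u z - r * z)" by (simp add: algebra_simps)
    qed (use e1 e2 cont in \<open>auto intro!: continuous_intros\<close>)
  qed
  then obtain d2 where d2: "d2 > 0"
    "\<And>y z. x \<le> y \<Longrightarrow> y < z \<Longrightarrow> z < x + d2 \<Longrightarrow> - (u y - r * y) \<le> - (u z - r * z)" by blast
  show thesis
  proof
    fix y z assume yz: "x \<le> y" "y < z" "z < x + min d1 d2"
    have "(p - e) * (z - y) \<le> q * (z - y)" "r * (z - y) \<le> (p + e) * (z - y)"
      using q r yz by (auto intro!: mult_right_mono)
    moreover have "q * (z - y) \<le> u z - u y" "u z - u y \<le> r * (z - y)"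
      using d1(2)[of y z] d2(2)[of y z] yz by (auto simp: algebra_simps)
    ultimately show "(p - e) * (z - y) \<le> u z - u y \<and> u z - u y \<le> (p + e) * (z - y)" by linarith
  qed (use d1 d2 in simp)
qed

lemma left_slopes:
  assumes u: "visc_sol a H lam u" and p: "(u has_real_derivative p) (at_left x)" and e: "e > 0"
  obtains d where "d > 0" "\<And>y z. x - d < y \<Longrightarrow> y < z \<Longrightarrow> z \<le> x \<Longrightarrow>
    (p - e) * (z - y) \<le> u z - u y \<and> u z - u y \<le> (p + e) * (z - y)"
proof -
  interpret R: degenerate_equation "\<lambda>x. a (- x)" "\<lambda>x p. H (- x) (- p)" K by (rule reflected)
  obtain d where d: "d > 0" "\<And>y z. - x \<le> y \<Longrightarrow> y < z \<Longrightarrow> z < - x + d \<Longrightarrow>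
    (- p - e) * (z - y) \<le> u (- z) - u (- y) \<and> u (- z) - u (- y) \<le> (- p + e) * (z - y)"
    using R.right_slopes[OF visc_sol_reflect[OF u] p[unfolded has_real_derivative_at_left_iff] e] by blast
  show thesis
  proof
    fix y z assume "x - d < y" "y < z" "z \<le> x"
    then show "(p - e) * (z - y) \<le> u z - u y \<and> u z - u y \<le> (p + e) * (z - y)"
      using d(2)[of "- z" "- y"] by (auto simp: algebra_simps)
  qed (rule d(1))
qed

lemma right_derivative_right_continuous:
  assumes u: "visc_sol a H lam u" and p: "(u has_real_derivative p) (at_right x)" and e: "e > 0"
  obtains d where "d > 0"
    "\<And>y w. x \<le> y \<Longrightarrow> y < x + d \<Longrightarrow> (u has_real_derivative w) (at_right y) \<Longrightarrow> \<bar>w - p\<bar> \<le> e"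
proof -
  obtain d where d: "d > 0" "\<And>y z. x \<le> y \<Longrightarrow> y < z \<Longrightarrow> z < x + d \<Longrightarrow>
    (p - e) * (z - y) \<le> u z - u y \<and> u z - u y \<le> (p + e) * (z - y)"
    using right_slopes[OF assms] by blast
  show thesis
  proof
    fix y w assume y: "x \<le> y" "y < x + d" "(u has_real_derivative w) (at_right y)"
    have "p - e \<le> w \<and> w \<le> p + e" by (rule right_derivative_between[OF y(3,2)]) (use d y in auto)
    then show "\<bar>w - p\<bar> \<le> e" by auto
  qed (rule d(1))
qed

text \<open>The limit at \<open>x\<close> is from the left, yet the derivatives at \<open>y\<close>
  are right-hand ones. Chords issuing from \<open>y\<close> control them, and a two-sided derivative
  at \<open>y\<close> is covered in particular.\<close>

lemma left_derivative_left_continuous: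
  assumes u: "visc_sol a H lam u" and p: "(u has_real_derivative p) (at_left x)" and e: "e > 0"
  obtains d where "d > 0"
    "\<And>y w. x - d < y \<Longrightarrow> y < x \<Longrightarrow> (u has_real_derivative w) (at_right y) \<Longrightarrow> \<bar>w - p\<bar> \<le> e"
proof -
  obtain d where d: "d > 0" "\<And>y z. x - d < y \<Longrightarrow> y < z \<Longrightarrow> z \<le> x \<Longrightarrow>
    (p - e) * (z - y) \<le> u z - u y \<and> u z - u y \<le> (p + e) * (z - y)"
    using left_slopes[OF assms] by blast
  show thesis
  proof
    fix y w assume y: "x - d < y" "y < x" "(u has_real_derivative w) (at_right y)"
    have "p - e \<le> w \<and> w \<le> p + e" by (rule right_derivative_between[OF y(3,2)]) (use d y in auto)
    then show "\<bar>w - p\<bar> \<le> e" by auto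
  qed (rule d(1))
qed

lemma derivative_continuous:
  assumes u: "visc_sol a H lam u" and p: "(u has_real_derivative p) (at x)" and e: "e > 0"
  obtains d where "d > 0"
    "\<And>y w. \<bar>y - x\<bar> < d \<Longrightarrow> (u has_real_derivative w) (at y) \<Longrightarrow> \<bar>w - p\<bar> \<le> e"
proof -
  have lr: "(u has_real_derivative p) (at_left x)" "(u has_real_derivative p) (at_right x)"
    using p has_real_derivative_at_iff_sides by blast+
  obtain d1 where d1: "d1 > 0"
    "\<And>y w. x \<le> y \<Longrightarrow> y < x + d1 \<Longrightarrow> (u has_real_derivative w) (at_right y) \<Longrightarrow> \<bar>w - p\<bar> \<le> e"
    using right_derivative_right_continuous[OF u lr(2) e] by blast
  obtain d2 where d2: "d2 > 0"
    "\<And>y w. x - d2 < y \<Longrightarrow> y < x \<Longrightarrow> (u has_real_derivative w) (at_right y) \<Longrightarrow> \<bar>w - p\<bar> \<le> e"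
    using left_derivative_left_continuous[OF u lr(1) e] by blast
  show thesis
  proof
    fix y w assume y: "\<bar>y - x\<bar> < min d1 d2" and "(u has_real_derivative w) (at y)"
    then have "(u has_real_derivative w) (at_right y)" using has_real_derivative_at_iff_sides by blast
    then show "\<bar>w - p\<bar> \<le> e" using d1(2)[of y w] d2(2)[of y w] y by (cases "y < x") auto
  qed (use d1 d2 in simp)
qed

section \<open>The equation at zeros of \<open>a\<close> and classical regularity elsewhere\<close>

lemma right_derivative_at_zero:
  assumes u: "visc_sol a H lam u" and x: "a x = 0" and p: "(u has_real_derivative p) (at_right x)"
  shows "H x p = lam"
proof (rule antisym)
  show "H x p \<le> lam"
    by (rule visc_super_right_derivative_at_zero[OF _ H_cont a_quadratic[OF x] K_nonneg p])
      (use u in \<open>simp add: visc_sol_def\<close>)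
  have "- H x (- (- p)) \<le> - lam"
    by (rule visc_super_right_derivative_at_zero[OF visc_sub_imp_super_uminus H_cont_minus
          a_quadratic[OF x] K_nonneg DERIV_minus[OF p]])
      (use u in \<open>simp add: visc_sol_def\<close>)
  then show "lam \<le> H x p" by simp
qed

lemma left_derivative_at_zero:
  assumes u: "visc_sol a H lam u" and x: "a x = 0" and p: "(u has_real_derivative p) (at_left x)"
  shows "H x p = lam"
proof -
  interpret R: degenerate_equation "\<lambda>x. a (- x)" "\<lambda>x p. H (- x) (- p)" K by (rule reflected)
  show ?thesis
    using R.right_derivative_at_zero[OF visc_sol_reflect[OF u] _ p[unfolded has_real_derivative_at_left_iff]] x
    by simp
qed

text \<open>The supersolution property excludes convex kinks, and the subsolution property, through
  \<open>- u\<close>, excludes concave ones.\<close>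

lemma differentiable_if_positive:
  assumes u: "visc_sol a H lam u" and x: "a x > 0"
  shows "(u has_real_derivative deriv u x) (at x)"
proof -
  obtain r p where r: "(u has_real_derivative r) (at_left x)" and p: "(u has_real_derivative p) (at_right x)"
    using left_derivative_exists[OF u] right_derivative_exists[OF u] by blast
  have sup: "visc_super a H lam u" and sub: "visc_sub a H lam u" using u unfolding visc_sol_def by auto
  have "p \<le> r" using visc_super_no_convex_kink[OF sup x r p] .
  moreover have "- p \<le> - r"
    using visc_super_no_convex_kink[OF visc_sub_imp_super_uminus[OF sub] x DERIV_minus[OF r] DERIV_minus[OF p]] .
  ultimately have "(u has_real_derivative p) (at x)" using r p has_real_derivative_at_iff_sides by force
  then show ?thesis using DERIV_imp_deriv by force
qed

lemma positive_nbhd: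
  assumes "a x > 0"
  obtains d where "d > 0" "\<And>z. \<bar>z - x\<bar> < d \<Longrightarrow> a z > 0"
proof -
  have "open {z. 0 < a z}" by (rule open_Collect_less) (use a_cont in auto)
  then show thesis using that assms unfolding open_dist dist_real_def by blast
qed

lemma isCont_deriv:
  assumes u: "visc_sol a H lam u" and x: "a x > 0"
  shows "isCont (deriv u) x"
proof -
  obtain d where d: "d > 0" "\<And>z. \<bar>z - x\<bar> < d \<Longrightarrow> a z > 0" using positive_nbhd[OF x] by blast
  have "\<exists>s>0. \<forall>z. \<bar>z - x\<bar> < s \<longrightarrow> \<bar>deriv u z - deriv u x\<bar> < e" if "e > 0" for e
  proof -
    have "e / 2 > 0" using that by simp
    then obtain d' where d': "d' > 0"
      "\<And>y w. \<bar>y - x\<bar> < d' \<Longrightarrow> (u has_real_derivative w) (at y) \<Longrightarrow> \<bar>w - deriv u x\<bar> \<le> e / 2"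
      using derivative_continuous[OF u differentiable_if_positive[OF u x]] by blast
    have "\<bar>deriv u z - deriv u x\<bar> < e" if "\<bar>z - x\<bar> < min d d'" for z
      using d'(2)[of z "deriv u z"] differentiable_if_positive[OF u d(2)[of z]] that \<open>e > 0\<close> by auto
    then show ?thesis using d d' by (intro exI[of _ "min d d'"]) auto
  qed
  then show ?thesis unfolding continuous_at_eps_delta dist_real_def by blast
qed

text \<open>The candidate \<open>G\<close> is continuous at \<open>x\<close>. Near \<open>x\<close>
  the growth estimate therefore applies to \<open>u\<close> with rate \<open>G x + f\<close> and to
  \<open>- u\<close> with rate \<open>- (G x - f)\<close>, which squeezes the difference quotients
  of \<open>deriv u\<close>.\<close>

lemma deriv_has_derivative:
  assumes u: "visc_sol a H lam u" and x: "a x > 0"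
  shows "(deriv u has_real_derivative (lam - H x (deriv u x)) / a x) (at x)"
proof -
  have sup: "visc_super a H lam u" and sub: "visc_sub a H lam u" using u unfolding visc_sol_def by auto
  define G where "G z = (lam - H z (deriv u z)) / a z" for z
  have iso: "isCont a x" using a_cont by (simp add: continuous_on_eq_continuous_at)
  have 1: "isCont (\<lambda>w. case w of (x, p) \<Rightarrow> H x p) (x, deriv u x)"
    using H_cont by (simp add: continuous_on_eq_continuous_at)
  have 2: "isCont (\<lambda>z. (z, deriv u z)) x"
    by (intro continuous_Pair isCont_deriv[OF u x] continuous_ident)
  have "isCont (\<lambda>z. H z (deriv u z)) x" using isCont_o2[OF 2 1] by simp
  then have "isCont G x" unfolding G_def using x iso by (auto intro!: continuous_intros)
  obtain d where d: "d > 0" "\<And>z. \<bar>z - x\<bar> < d \<Longrightarrow> a z > 0" using positive_nbhd[OF x] by blast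
  have "((\<lambda>y. (deriv u y - deriv u x) / (y - x)) \<longlongrightarrow> G x) (at x)"
  proof (rule LIM_I)
    fix e :: real assume "e > 0"
    define f where "f = e / 2"
    have "f > 0" using \<open>e > 0\<close> unfolding f_def by simp
    then obtain s where s: "s > 0" "\<And>z. \<bar>z - x\<bar> < s \<Longrightarrow> \<bar>G z - G x\<bar> < f"
      using \<open>isCont G x\<close> unfolding continuous_at_eps_delta dist_real_def by blast
    define t where "t = min d s"
    have t: "t > 0" using d s unfolding t_def by simp
    have der: "(u has_real_derivative deriv u z) (at z)" if "x - t < z" "z < x + t" for z
      using differentiable_if_positive[OF u d(2)] that unfolding t_def by auto
    have G: "lam < a z * (G x + f) + H z (deriv u z)" "a z * (G x - f) + H z (deriv u z) < lam"
      if "x - t < z" "z < x + t" for z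
    proof -
      have az: "a z > 0" using d(2)[of z] that unfolding t_def by auto
      have "\<bar>G z - G x\<bar> < f" using s(2)[of z] that unfolding t_def by auto
      then have "a z * G z < a z * (G x + f)" "a z * (G x - f) < a z * G z"
        using az by (auto intro!: mult_strict_left_mono)
      moreover have "a z * G z = lam - H z (deriv u z)" unfolding G_def using az by simp
      ultimately show "lam < a z * (G x + f) + H z (deriv u z)" "a z * (G x - f) + H z (deriv u z) < lam"
        by linarith+
    qed
    have up: "deriv u z - deriv u y \<le> (G x + f) * (z - y)" if "x - t < y" "y < z" "z < x + t" for y z
      by (rule visc_super_derivative_growth[where w = "deriv u", OF sup der G(1) that])
    have lo: "(G x - f) * (z - y) \<le> deriv u z - deriv u y" if "x - t < y" "y < z" "z < x + t" for y z
    proof -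
      have "- deriv u z - - deriv u y \<le> - (G x - f) * (z - y)"
      proof (rule visc_super_derivative_growth[where w = "\<lambda>z. - deriv u z",
            OF visc_sub_imp_super_uminus[OF sub] DERIV_minus[OF der] _ that])
        show "- lam < a z * - (G x - f) + - H z (- (- deriv u z))" if "x - t < z" "z < x + t" for z
          using G(2)[OF that] by (simp add: algebra_simps)
      qed
      then show ?thesis by (simp add: algebra_simps)
    qed
    show "\<exists>s>0. \<forall>y. y \<noteq> x \<and> norm (y - x) < s \<longrightarrow> norm ((deriv u y - deriv u x) / (y - x) - G x) < e"
    proof (intro exI[of _ t] conjI allI impI t)
      fix y assume y: "y \<noteq> x \<and> norm (y - x) < t"
      have "G x - f \<le> (deriv u y - deriv u x) / (y - x) \<and> (deriv u y - deriv u x) / (y - x) \<le> G x + f"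
      proof (cases "x < y")
        case True
        then show ?thesis using up[of x y] lo[of x y] y t by (simp add: field_simps)
      next
        case False
        then have "y < x" using y by simp
        have "(deriv u y - deriv u x) / (y - x) = (deriv u x - deriv u y) / (x - y)"
          by (metis minus_diff_eq minus_divide_divide)
        then show ?thesis using up[of y x] lo[of y x] y t \<open>y < x\<close> by (simp add: field_simps)
      qed
      then show "norm ((deriv u y - deriv u x) / (y - x) - G x) < e"
        using \<open>e > 0\<close> unfolding f_def real_norm_def by linarith
    qed
  qed
  then show ?thesis unfolding has_field_derivative_iff G_def .
qed

end

section \<open>Uniqueness\<close>

text \<open>The comparison is needed at individual zeros of \<open>a\<close>, which an almost
  everywhere inequality does not see; one-sided derivatives exist at every point.\<close>

definition one_sided_deriv_ge :: "(real \<Rightarrow> real) \<Rightarrow> (real \<Rightarrow> real) \<Rightarrow> bool" where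
  "one_sided_deriv_ge u v \<longleftrightarrow> (\<forall>x p r.
     ((u has_real_derivative p) (at_right x) \<and> (v has_real_derivative r) (at_right x) \<longrightarrow> r \<le> p) \<and>
     ((u has_real_derivative p) (at_left x) \<and> (v has_real_derivative r) (at_left x) \<longrightarrow> r \<le> p))"

lemma one_sided_deriv_ge_reflect:
  assumes "one_sided_deriv_ge v u"
  shows "one_sided_deriv_ge (\<lambda>x. u (- x)) (\<lambda>x. v (- x))"
proof -
  have *: "((\<lambda>x. u (- x)) has_real_derivative p) (at_right x) \<longleftrightarrow> (u has_real_derivative - p) (at_left (- x))"
    "((\<lambda>x. u (- x)) has_real_derivative p) (at_left x) \<longleftrightarrow> (u has_real_derivative - p) (at_right (- x))"
    for u :: "real \<Rightarrow> real" and p x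
    by (simp_all add: has_real_derivative_at_left_iff)
  have l: "p \<le> r" if "(v has_real_derivative r) (at_left x)" "(u has_real_derivative p) (at_left x)" for x p r
    using assms that unfolding one_sided_deriv_ge_def by blast
  have r: "p \<le> r" if "(v has_real_derivative r) (at_right x)" "(u has_real_derivative p) (at_right x)" for x p r
    using assms that unfolding one_sided_deriv_ge_def by blast
  show ?thesis unfolding one_sided_deriv_ge_def *
    using l r neg_le_iff_le by blast
qed

context degenerate_equation
begin

section \<open>From the almost everywhere comparison to every point\<close>

text \<open>\<open>deriv_ge_ae\<close> says nothing where a derivative is missing; the kinks of
  \<open>u\<close> and \<open>v\<close> are countable, hence null, so an interval of positive length
  contains a point where it has content.\<close>

lemma exists_ordered_derivatives:
  assumes u: "visc_sol a H lam u" and v: "visc_sol a H mu v"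
    and ge: "deriv_ge_ae u v" and st: "s < t"
  obtains z du dv where "s < z" "z < t" "(u has_real_derivative du) (at z)"
    "(v has_real_derivative dv) (at z)" "dv \<le> du"
proof (rule ccontr)
  assume no: "\<not> thesis"
  have nu: "AE x in lborel. x \<notin> {x. \<not> (\<exists>p. (w has_real_derivative p) (at x))}"
    if "visc_sol a H l w" for w l
    by (intro AE_not_in countable_imp_null_set_lborel countable_kinks
        left_derivative_exists[OF that] right_derivative_exists[OF that])
  have "AE x in lborel. x \<notin> {s<..<t}"
    using nu[OF u] nu[OF v] ge[unfolded deriv_ge_ae_def]
  proof eventually_elim
    case (elim x)
    then obtain du dv where "(u has_real_derivative du) (at x)" "(v has_real_derivative dv) (at x)" "dv \<le> du"
      by blast
    then show ?case using no that[of x du dv] by auto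
  qed
  then have "{s<..<t} \<in> null_sets lborel" by (simp add: AE_iff_null_sets)
  then show False using st by (simp add: null_sets_def)
qed

text \<open>Points with ordered derivatives accumulate at \<open>x\<close> from either side, and
  one-sided continuity carries the inequality to the limit.\<close>

lemma deriv_ge_ae_imp_one_sided:
  assumes u: "visc_sol a H lam u" and v: "visc_sol a H mu v" and ge: "deriv_ge_ae u v"
  shows "one_sided_deriv_ge u v"
  unfolding one_sided_deriv_ge_def
proof (intro allI conjI impI)
  fix x p r
  assume "(u has_real_derivative p) (at_right x) \<and> (v has_real_derivative r) (at_right x)"
  then have p: "(u has_real_derivative p) (at_right x)" and r: "(v has_real_derivative r) (at_right x)" by auto
  have "r \<le> p + e" if "e > 0" for e
  proof -
    have e: "e / 2 > 0" using that by simp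
    obtain d1 where d1: "d1 > 0"
      "\<And>y w. x \<le> y \<Longrightarrow> y < x + d1 \<Longrightarrow> (u has_real_derivative w) (at_right y) \<Longrightarrow> \<bar>w - p\<bar> \<le> e / 2"
      using right_derivative_right_continuous[OF u p e] by blast
    obtain d2 where d2: "d2 > 0"
      "\<And>y w. x \<le> y \<Longrightarrow> y < x + d2 \<Longrightarrow> (v has_real_derivative w) (at_right y) \<Longrightarrow> \<bar>w - r\<bar> \<le> e / 2"
      using right_derivative_right_continuous[OF v r e] by blast
    have "x < x + min d1 d2" using d1 d2 by simp
    then obtain z du dv where z: "x < z" "z < x + min d1 d2" "(u has_real_derivative du) (at z)"
        "(v has_real_derivative dv) (at z)" "dv \<le> du"
      using exists_ordered_derivatives[OF u v ge] by blast
    have "\<bar>du - p\<bar> \<le> e / 2" "\<bar>dv - r\<bar> \<le> e / 2"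
      using d1(2)[of z du] d2(2)[of z dv] z has_real_derivative_at_iff_sides by auto
    then show ?thesis using z(5) by linarith
  qed
  then show "r \<le> p" by (rule field_le_epsilon)
next
  fix x p r
  assume "(u has_real_derivative p) (at_left x) \<and> (v has_real_derivative r) (at_left x)"
  then have p: "(u has_real_derivative p) (at_left x)" and r: "(v has_real_derivative r) (at_left x)" by auto
  have "r \<le> p + e" if "e > 0" for e
  proof -
    have e: "e / 2 > 0" using that by simp
    obtain d1 where d1: "d1 > 0"
      "\<And>y w. x - d1 < y \<Longrightarrow> y < x \<Longrightarrow> (u has_real_derivative w) (at_right y) \<Longrightarrow> \<bar>w - p\<bar> \<le> e / 2"
      using left_derivative_left_continuous[OF u p e] by blast
    obtain d2 where d2: "d2 > 0"
      "\<And>y w. x - d2 < y \<Longrightarrow> y < x \<Longrightarrow> (v has_real_derivative w) (at_right y) \<Longrightarrow> \<bar>w - r\<bar> \<le> e / 2"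
      using left_derivative_left_continuous[OF v r e] by blast
    have "x - min d1 d2 < x" using d1 d2 by simp
    then obtain z du dv where z: "x - min d1 d2 < z" "z < x" "(u has_real_derivative du) (at z)"
        "(v has_real_derivative dv) (at z)" "dv \<le> du"
      using exists_ordered_derivatives[OF u v ge] by blast
    have "\<bar>du - p\<bar> \<le> e / 2" "\<bar>dv - r\<bar> \<le> e / 2"
      using d1(2)[of z du] d2(2)[of z dv] z has_real_derivative_at_iff_sides by auto
    then show ?thesis using z(5) by linarith
  qed
  then show "r \<le> p" by (rule field_le_epsilon)
qed

section \<open>The increasing branch of \<open>H\<close> and agreement of derivatives\<close>

text \<open>Of two such roots the smaller would lie between a point with value below
  \<open>lam\<close> and the larger root, so its own value would be below \<open>lam\<close>. The
  lower points \<open>r\<close> and \<open>r'\<close> may differ, as derivatives of different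
  \<open>v\<close> or from different sides do.\<close>

lemma upper_root_unique:
  assumes "H x p = lam" "r \<le> p" "H x r < lam" "H x p' = lam" "r' \<le> p'" "H x r' < lam"
  shows "p = p'"
proof (rule ccontr)
  have o: "r < p" "r' < p'" using assms by (auto simp: less_le)
  assume "p \<noteq> p'"
  then consider "p < p'" | "p' < p" by linarith
  then show False
    by cases (use H_quasiconvex[of r p p' x] H_quasiconvex[of r' p' p x] o assms in auto)
qed

text \<open>The pair \<open>r < q\<close> certifies the increasing branch by a strict inequality,
  which persists when \<open>x\<close> varies, so no control of the minimiser of \<open>H x\<close>
  is required.\<close>

lemma H_increasing_above:
  assumes "r < q" "H x r < H x q" "q \<le> s" "s \<le> t"
  shows "H x s \<le> H x t"
proof (cases "s < t")
  case True
  have "H x q < max (H x r) (H x t)" using H_quasiconvex[of r q t x] assms True by auto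
  then have "H x r < H x t" using assms(2) by auto
  moreover have "H x s < max (H x r) (H x t)" using H_quasiconvex[of r s t x] assms True by auto
  ultimately show ?thesis by auto
qed (use assms in auto)

lemma derivatives_at_zero_agree:
  assumes u: "visc_sol a H lam u1" "visc_sol a H lam u2"
    and v: "visc_sol a H mu v1" "visc_sol a H mu v2" and mu: "mu < lam"
    and ge: "one_sided_deriv_ge u1 v1" "one_sided_deriv_ge u2 v2" and x: "a x = 0"
  obtains p r where "(u1 has_real_derivative p) (at x)" "(u2 has_real_derivative p) (at x)"
    "r < p" "H x p = lam" "H x r = mu"
proof -
  have R: "\<exists>p r. (w has_real_derivative p) (at_right x) \<and> H x p = lam \<and> H x r = mu \<and> r \<le> p"
    if w: "visc_sol a H lam w" and z: "visc_sol a H mu z" and g: "one_sided_deriv_ge w z" for w z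
    using right_derivative_exists[OF w, of x] right_derivative_exists[OF z, of x]
      right_derivative_at_zero[OF w x] right_derivative_at_zero[OF z x] g
    unfolding one_sided_deriv_ge_def by metis
  have L: "\<exists>p r. (w has_real_derivative p) (at_left x) \<and> H x p = lam \<and> H x r = mu \<and> r \<le> p"
    if w: "visc_sol a H lam w" and z: "visc_sol a H mu z" and g: "one_sided_deriv_ge w z" for w z
    using left_derivative_exists[OF w, of x] left_derivative_exists[OF z, of x]
      left_derivative_at_zero[OF w x] left_derivative_at_zero[OF z x] g
    unfolding one_sided_deriv_ge_def by metis
  obtain p r where p: "(u1 has_real_derivative p) (at_right x)" "H x p = lam" "H x r = mu" "r \<le> p"
    using R[OF u(1) v(1) ge(1)] by blast
  have eq: "p' = p" if "H x p' = lam" "H x r' = mu" "r' \<le> p'" for p' r'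
    using upper_root_unique[of x p' lam r' p r] that p mu by auto
  have "(u1 has_real_derivative p) (at_left x)" "(u2 has_real_derivative p) (at_right x)"
    "(u2 has_real_derivative p) (at_left x)"
    using L[OF u(1) v(1) ge(1)] R[OF u(2) v(2) ge(2)] L[OF u(2) v(2) ge(2)] eq by blast+
  moreover have "r < p" using p mu by (cases "r = p") auto
  ultimately show thesis using that p has_real_derivative_at_iff_sides by metis
qed

lemma last_zero_before:
  assumes "a x > 0"
  obtains l where "l < x" "a l = 0" "\<And>z. l < z \<Longrightarrow> z \<le> x \<Longrightarrow> a z > 0"
proof -
  define S where "S = {z. z \<le> x \<and> a z = 0}"
  have S: "S \<noteq> {}" "bdd_above S" using a_zero_left[of x] unfolding S_def by force+
  have "closed ({..x} \<inter> {z. a z = 0})"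
    by (intro closed_Int closed_Collect_eq) (use a_cont in auto)
  moreover have "S = {..x} \<inter> {z. a z = 0}" unfolding S_def by auto
  ultimately have "Sup S \<in> S" using closed_contains_Sup S by metis
  then have l: "Sup S < x" "a (Sup S) = 0" using assms unfolding S_def by (auto simp: less_le)
  have "a z > 0" if "Sup S < z" "z \<le> x" for z
  proof (rule ccontr)
    assume "\<not> a z > 0"
    then have "z \<in> S" using a_nonneg[of z] that unfolding S_def by auto
    then show False using cSup_upper[OF _ S(2)] that by force
  qed
  then show thesis using that l by blast
qed

text \<open>Gronwall argument: on the compact interval \<open>a\<close> is bounded away from 0 and
  the slopes are bounded, so the equation for the derivative is Lipschitz in the slope.\<close>

lemma derivatives_agree_forward:
  assumes u: "visc_sol a H lam u1" "visc_sol a H lam u2"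
    and bx: "b \<le> x" and pos: "\<And>z. b \<le> z \<Longrightarrow> z \<le> x \<Longrightarrow> a z > 0"
    and eq: "deriv u1 b = deriv u2 b"
  shows "deriv u1 x = deriv u2 x"
proof -
  define D where "D z = deriv u1 z - deriv u2 z" for z
  obtain M where M: "\<And>x y. x < y \<Longrightarrow> \<bar>(u1 y - u1 x) / (y - x)\<bar> \<le> M"
    using visc_super_quotient_bound u(1) unfolding visc_sol_def by blast
  obtain N where N: "\<And>x y. x < y \<Longrightarrow> \<bar>(u2 y - u2 x) / (y - x)\<bar> \<le> N"
    using visc_super_quotient_bound u(2) unfolding visc_sol_def by blast
  have bound: "\<bar>w\<bar> \<le> B"
    if B: "\<And>x y. x < y \<Longrightarrow> \<bar>(v y - v x) / (y - x)\<bar> \<le> B" and w: "(v has_real_derivative w) (at z)"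
    for v w z and B :: real
  proof -
    have "- B \<le> w \<and> w \<le> B"
    proof (rule right_derivative_between[of v w z "z + 1"])
      show "(v has_real_derivative w) (at_right z)" using w has_real_derivative_at_iff_sides by blast
      fix y assume "z < y" "y < z + 1"
      then show "- B * (y - z) \<le> v y - v z \<and> v y - v z \<le> B * (y - z)"
        using abs_le_D1[OF B[of z y]] abs_le_D2[OF B[of z y]] by (auto simp: field_simps)
    qed simp
    then show ?thesis by auto
  qed
  obtain L where L: "\<And>x p q. \<bar>p\<bar> \<le> max M N \<Longrightarrow> \<bar>q\<bar> \<le> max M N \<Longrightarrow> \<bar>H x p - H x q\<bar> \<le> L * \<bar>p - q\<bar>"
    using H_lipschitz[of "max M N"] by blast
  obtain m where m: "m \<in> {b..x}" "\<And>z. z \<in> {b..x} \<Longrightarrow> a m \<le> a z"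
    using continuous_attains_inf[of "{b..x}" a] bx continuous_on_subset[OF a_cont] by auto
  have am: "a m > 0" using pos m(1) by auto
  \<comment> \<open>With this rate the derivative of \<open>(D z)\<^sup>2\<close> is at most
    \<open>k * (D z)\<^sup>2\<close>; the absolute value is there because the sign of
    \<open>L\<close> is unknown.\<close>
  define k where "k = 2 * \<bar>L\<bar> / a m"
  define F where "F z = (D z)\<^sup>2 * exp (- k * z)" for z
  have "F x \<le> F b"
  proof (rule DERIV_nonpos_imp_nonincreasing[OF bx])
    fix z assume z: "b \<le> z" "z \<le> x"
    have az: "a z > 0" "a m \<le> a z" using pos z m(2)[of z] by auto
    define h where "h = H z (deriv u1 z) - H z (deriv u2 z)"
    have D': "(D has_real_derivative - h / a z) (at z)"
      unfolding D_def h_def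
      by (rule DERIV_cong[OF DERIV_diff[OF deriv_has_derivative[OF u(1) az(1)] deriv_has_derivative[OF u(2) az(1)]]])
        (simp flip: diff_divide_distrib)
    have F': "(F has_real_derivative (2 * D z * (- h / a z) - k * (D z)\<^sup>2) * exp (- k * z)) (at z)"
      unfolding F_def by (rule derivative_eq_intros D' refl | simp add: algebra_simps)+
    have "\<bar>h\<bar> \<le> L * \<bar>D z\<bar>" unfolding h_def D_def
      using bound[OF M differentiable_if_positive[OF u(1) az(1)]] bound[OF N differentiable_if_positive[OF u(2) az(1)]]
      by (intro L) auto
    also have "\<dots> \<le> \<bar>L\<bar> * \<bar>D z\<bar>" by (intro mult_right_mono) auto
    finally have "\<bar>h\<bar> \<le> \<bar>L\<bar> * \<bar>D z\<bar>" .
    then have hb: "\<bar>h\<bar> / a z \<le> \<bar>L\<bar> * \<bar>D z\<bar> / a m" using az am by (intro frac_le) auto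
    have "2 * D z * (- h / a z) \<le> \<bar>2 * D z * (- h / a z)\<bar>" by (rule abs_ge_self)
    also have "\<dots> = 2 * \<bar>D z\<bar> * (\<bar>h\<bar> / a z)" using az by (simp add: abs_mult)
    also have "\<dots> \<le> 2 * \<bar>D z\<bar> * (\<bar>L\<bar> * \<bar>D z\<bar> / a m)" by (intro mult_left_mono hb) auto
    also have "\<dots> = k * (D z)\<^sup>2" unfolding k_def by (simp add: power2_eq_square)
    finally have "2 * D z * (- h / a z) - k * (D z)\<^sup>2 \<le> 0" by simp
    then have "(2 * D z * (- h / a z) - k * (D z)\<^sup>2) * exp (- k * z) \<le> 0"
      by (simp add: mult_nonpos_nonneg)
    with F' show "\<exists>y. (F has_real_derivative y) (at z) \<and> y \<le> 0" by blast
  qed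
  moreover have "F b = 0" unfolding F_def D_def using eq by simp
  ultimately have "(D x)\<^sup>2 * exp (- k * x) \<le> 0" unfolding F_def by simp
  then have "(D x)\<^sup>2 \<le> 0" by (simp add: mult_le_0_iff)
  then show ?thesis unfolding D_def by simp
qed

text \<open>The equation is singular at the endpoint \<open>l\<close>, where \<open>a\<close>
  vanishes quadratically, so Gronwall cannot start there. Monotonicity of \<open>H\<close> settles a
  small interval up to \<open>b\<close>, and Gronwall continues from \<open>b\<close> to
  \<open>x\<close>.\<close>

lemma derivatives_agree_if_positive:
  assumes u: "visc_sol a H lam u1" "visc_sol a H lam u2"
    and v: "visc_sol a H mu v1" "visc_sol a H mu v2" and mu: "mu < lam"
    and ge: "one_sided_deriv_ge u1 v1" "one_sided_deriv_ge u2 v2" and x: "a x > 0"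
  shows "deriv u1 x = deriv u2 x"
proof -
  obtain l where l: "l < x" "a l = 0" "\<And>z. l < z \<Longrightarrow> z \<le> x \<Longrightarrow> a z > 0"
    using last_zero_before[OF x] by blast
  obtain p r where p: "(u1 has_real_derivative p) (at l)" "(u2 has_real_derivative p) (at l)"
      "r < p" "H l p = lam" "H l r = mu"
    using derivatives_at_zero_agree[OF u v mu ge l(2)] by blast
  have "mu < H l p" using p mu by simp
  then obtain e where e: "e > 0" "\<And>z q. \<bar>z - l\<bar> < e \<Longrightarrow> \<bar>q - p\<bar> < e \<Longrightarrow> mu < H z q"
    using continuous_pair_nbhd[OF H_cont] by blast
  \<comment> \<open>\<open>q\<close> lies strictly between \<open>r\<close> and \<open>p\<close>,
    close enough to \<open>p\<close> that \<open>H l q > mu = H l r\<close>.\<close>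
  define q where "q = max ((r + p) / 2) (p - e / 2)"
  have q: "r < q" "q < p" "\<bar>q - p\<bar> < e" using p(3) e(1) unfolding q_def by (auto simp: max_def field_simps abs_if)
  have "H l r < H l q" using e q p by simp
  \<comment> \<open>The level \<open>c\<close> separates the two values, so that
    \<open>H z r < H z q\<close> persists for \<open>z\<close> near \<open>l\<close>.\<close>
  then obtain c where c: "H l r < c" "c < H l q" using dense by blast
  obtain d1 where d1: "d1 > 0" "\<And>z. \<bar>z - l\<bar> < d1 \<Longrightarrow> H z r < c" using H_lt_nbhd[OF c(1)] by blast
  obtain d2 where d2: "d2 > 0" "\<And>z. \<bar>z - l\<bar> < d2 \<Longrightarrow> c < H z q" using H_gt_nbhd[OF c(2)] by blast
  have near: "\<exists>d>0. \<forall>z. l < z \<and> z \<le> x \<and> z < l + d \<longrightarrow> \<bar>deriv u1 z - p\<bar> \<le> e \<and> \<bar>deriv u2 z - p\<bar> \<le> e"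
    if pos: "e > 0" for e
  proof -
    obtain s1 where s1: "s1 > 0"
      "\<And>y w. \<bar>y - l\<bar> < s1 \<Longrightarrow> (u1 has_real_derivative w) (at y) \<Longrightarrow> \<bar>w - p\<bar> \<le> e"
      using derivative_continuous[OF u(1) p(1) pos] by blast
    obtain s2 where s2: "s2 > 0"
      "\<And>y w. \<bar>y - l\<bar> < s2 \<Longrightarrow> (u2 has_real_derivative w) (at y) \<Longrightarrow> \<bar>w - p\<bar> \<le> e"
      using derivative_continuous[OF u(2) p(2) pos] by blast
    have "\<bar>deriv u1 z - p\<bar> \<le> e \<and> \<bar>deriv u2 z - p\<bar> \<le> e" if "l < z" "z \<le> x" "z < l + min s1 s2" for z
      using s1(2)[OF _ differentiable_if_positive[OF u(1) l(3)[OF that(1,2)]]]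
        s2(2)[OF _ differentiable_if_positive[OF u(2) l(3)[OF that(1,2)]]] that by auto
    then show ?thesis using s1 s2 by (intro exI[of _ "min s1 s2"]) auto
  qed
  \<comment> \<open>The tolerance \<open>p - q\<close> keeps both derivatives above
    \<open>q\<close>, on the increasing branch.\<close>
  have "p - q > 0" using q by simp
  then obtain d3 where d3: "d3 > 0"
    "\<And>z. l < z \<Longrightarrow> z \<le> x \<Longrightarrow> z < l + d3 \<Longrightarrow> \<bar>deriv u1 z - p\<bar> \<le> p - q \<and> \<bar>deriv u2 z - p\<bar> \<le> p - q"
    using near by blast
  define b where "b = min x (l + min (min d1 d2) d3 / 2)"
  have b: "l < b" "b \<le> x" "b < l + d1" "b < l + d2" "b < l + d3"
    using l(1) d1(1) d2(1) d3(1) unfolding b_def by (auto simp: min_def)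
  define D where "D z = deriv u1 z - deriv u2 z" for z
  have mono: "(D b)\<^sup>2 \<le> (D y)\<^sup>2" if y: "l < y" "y \<le> b" for y
  proof (rule DERIV_nonpos_imp_nonincreasing[OF y(2)])
    fix z assume z: "y \<le> z" "z \<le> b"
    then have az: "a z > 0" using l(3) y b by auto
    define h where "h = H z (deriv u1 z) - H z (deriv u2 z)"
    have D': "(D has_real_derivative - h / a z) (at z)"
      unfolding D_def h_def
      by (rule DERIV_cong[OF DERIV_diff[OF deriv_has_derivative[OF u(1) az] deriv_has_derivative[OF u(2) az]]])
        (simp flip: diff_divide_distrib)
    have E': "((\<lambda>z. (D z)\<^sup>2) has_real_derivative 2 * D z * (- h / a z)) (at z)"
      by (rule derivative_eq_intros D' refl | simp)+
    have w: "q \<le> deriv u1 z" "q \<le> deriv u2 z" using d3(2)[of z] z y b by auto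
    have "H z r < H z q" using d1(2)[of z] d2(2)[of z] z y b by auto
    \<comment> \<open>Monotonicity gives \<open>D z\<close> and \<open>h\<close> the same sign,
      which makes \<open>(D z)\<^sup>2\<close> nonincreasing however small \<open>a z\<close>
      is.\<close>
    then have "0 \<le> D z * h"
      using H_increasing_above[OF q(1), of z "deriv u1 z" "deriv u2 z"]
        H_increasing_above[OF q(1), of z "deriv u2 z" "deriv u1 z"] w
      unfolding D_def h_def zero_le_mult_iff by linarith
    then have "2 * (D z * h) / a z \<ge> 0" using az by simp
    then have "2 * D z * (- h / a z) \<le> 0" by (simp add: mult.assoc)
    with E' show "\<exists>y. ((\<lambda>z. (D z)\<^sup>2) has_real_derivative y) (at z) \<and> y \<le> 0" by blast
  qed
  \<comment> \<open>\<open>\<bar>D b\<bar>\<close> is at most \<open>\<bar>D y\<bar>\<close> for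
    \<open>y\<close> between \<open>l\<close> and \<open>b\<close>, and this tends to 0 at
    \<open>l\<close> because both derivatives tend to \<open>p\<close>.\<close>
  have "\<bar>D b\<bar> \<le> 0 + e" if "e > 0" for e
  proof -
    have "e / 2 > 0" using that by simp
    then obtain d where d: "d > 0"
      "\<And>z. l < z \<Longrightarrow> z \<le> x \<Longrightarrow> z < l + d \<Longrightarrow> \<bar>deriv u1 z - p\<bar> \<le> e / 2 \<and> \<bar>deriv u2 z - p\<bar> \<le> e / 2"
      using near by blast
    define y where "y = min b (l + d / 2)"
    have y: "l < y" "y \<le> b" "y < l + d" using b d unfolding y_def by (auto simp: min_def)
    have "y \<le> x" using y b by simp
    then have "\<bar>D y\<bar> \<le> e" using d(2)[OF y(1) _ y(3)] unfolding D_def by linarith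
    moreover have "\<bar>D b\<bar> \<le> \<bar>D y\<bar>" using mono[OF y(1,2)] by (simp add: abs_le_square_iff)
    ultimately show ?thesis by simp
  qed
  then have "\<bar>D b\<bar> \<le> 0" by (rule field_le_epsilon)
  then have "deriv u1 b = deriv u2 b" unfolding D_def by simp
  then show ?thesis using derivatives_agree_forward[OF u b(2)] l(3) b(1) by auto
qed

lemma difference_constant:
  assumes u: "visc_sol a H lam u1" "visc_sol a H lam u2"
    and v: "visc_sol a H mu v1" "visc_sol a H mu v2" and mu: "mu < lam"
    and ge: "one_sided_deriv_ge u1 v1" "one_sided_deriv_ge u2 v2"
  shows "\<exists>c. \<forall>x. u1 x - u2 x = c"
proof -
  have "((\<lambda>x. u1 x - u2 x) has_real_derivative 0) (at x)" for x
  proof (cases "a x = 0")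
    case True
    then obtain p where "(u1 has_real_derivative p) (at x)" "(u2 has_real_derivative p) (at x)"
      using derivatives_at_zero_agree[OF u v mu ge] by metis
    from DERIV_diff[OF this] show ?thesis by simp
  next
    case False
    then have x: "a x > 0" using a_nonneg[of x] by linarith
    show ?thesis
      using DERIV_diff[OF differentiable_if_positive[OF u(1) x] differentiable_if_positive[OF u(2) x]]
        derivatives_agree_if_positive[OF u v mu ge x] by simp
  qed
  then have "u1 x - u2 x = u1 0 - u2 0" for x using DERIV_isconst_all by blast
  then show ?thesis by blast
qed

end

section \<open>The structural assumptions and the conclusion\<close>

lemma degenerate_equationI:
  assumes a: "diff_coeff \<kappa> a" and H: "H_sqc \<alpha>0 \<alpha>1 \<gamma> \<eta> H" and \<gamma>: "\<gamma> > 2"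
  shows "degenerate_equation a H (\<kappa>\<^sup>2)"
proof
  have a01: "0 \<le> a x" for x using a unfolding diff_coeff_def by blast
  have lip: "\<kappa>-lipschitz_on UNIV (\<lambda>x. sqrt (a x))" using a unfolding diff_coeff_def by blast
  have bdd: "bounded (connected_component_set {y. a y > 0} x)" if "a x > 0" for x
    using a that unfolding diff_coeff_def by blast
  show "a x \<ge> 0" for x by (rule a01)
  show "\<kappa>\<^sup>2 \<ge> 0" by simp
  have "continuous_on UNIV (\<lambda>x. sqrt (a x))" using lip by (rule lipschitz_on_continuous_on)
  then have "continuous_on UNIV (\<lambda>x. (sqrt (a x))\<^sup>2)" by (rule continuous_on_power)
  then show "continuous_on UNIV a" using a01 by simp
  show "a x \<le> \<kappa>\<^sup>2 * (x - x0)\<^sup>2" if "a x0 = 0" for x x0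
  proof -
    have "sqrt (a x) \<le> \<kappa> * \<bar>x - x0\<bar>"
      using lipschitz_onD[OF lip, of x x0] that a01 by (simp add: dist_real_def)
    then have "(sqrt (a x))\<^sup>2 \<le> (\<kappa> * \<bar>x - x0\<bar>)\<^sup>2" using a01 by (intro power_mono) auto
    then show ?thesis using a01 by (simp add: power_mult_distrib)
  qed
  show "\<exists>z<x. a z = 0" for x
  proof (rule ccontr)
    assume "\<not> (\<exists>z<x. a z = 0)"
    then have pos: "a z > 0" if "z < x" for z using that a01[of z] by (metis less_eq_real_def)
    \<comment> \<open>Were \<open>a\<close> positive on the whole half-line, this connected
      unbounded set would lie in a single component.\<close>
    have "{..<x} \<subseteq> connected_component_set {y. a y > 0} (x - 1)"
      by (rule connected_component_maximal) (auto simp: pos)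
    then have "bounded {..<x}" using bdd[OF pos[of "x - 1"]] bounded_subset by auto
    then obtain B where B: "\<And>z. z < x \<Longrightarrow> \<bar>z\<bar> \<le> B" unfolding bounded_iff by auto
    then show False using B[of "min (x - 1) (- \<bar>B\<bar> - 1)"] by linarith
  qed
  show "\<exists>z>x. a z = 0" for x
  proof (rule ccontr)
    assume "\<not> (\<exists>z>x. a z = 0)"
    then have pos: "a z > 0" if "z > x" for z using that a01[of z] by (metis less_eq_real_def)
    have "{x<..} \<subseteq> connected_component_set {y. a y > 0} (x + 1)"
      by (rule connected_component_maximal) (auto simp: pos)
    then have "bounded {x<..}" using bdd[OF pos[of "x + 1"]] bounded_subset by auto
    then obtain B where B: "\<And>z. x < z \<Longrightarrow> \<bar>z\<bar> \<le> B" unfolding bounded_iff by auto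
    then show False using B[of "max (x + 1) (\<bar>B\<bar> + 1)"] by linarith
  qed
  note H0 = H[unfolded H_sqc_def]
  note H0' = H0[THEN conjunct2, THEN conjunct2]
  have \<alpha>: "0 < \<alpha>0" "0 < \<alpha>1" using H0[THEN conjunct1] H0[THEN conjunct2, THEN conjunct1] by blast+
  have H1: "\<alpha>0 * \<bar>p\<bar> powr \<gamma> - 1 / \<alpha>0 \<le> H x p" for x p
    using H0'[THEN conjunct1] by blast
  have H2: "\<bar>H x p - H x q\<bar> \<le> \<alpha>1 * (\<bar>p\<bar> + \<bar>q\<bar> + 1) powr (\<gamma> - 1) * \<bar>p - q\<bar>" for x p q
    using H0'[THEN conjunct2, THEN conjunct1] by blast
  have H3: "\<bar>H x p - H y p\<bar> \<le> \<alpha>1 * (\<bar>p\<bar> powr \<gamma> + 1) * \<bar>x - y\<bar>" for x y p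
    using H0'[THEN conjunct2, THEN conjunct2, THEN conjunct1] by blast
  have H4: "H x (t * p + (1 - t) * q) < max (H x p) (H x q)" if "p \<noteq> q" "0 < t" "t < 1" for x p q t
    using H0'[THEN conjunct2, THEN conjunct2, THEN conjunct2, THEN conjunct1] that by blast
  have H2': "\<bar>H x p - H x q\<bar> \<le> \<alpha>1 * (2 * R + 1) powr (\<gamma> - 1) * \<bar>p - q\<bar>"
    if "\<bar>p\<bar> \<le> R" "\<bar>q\<bar> \<le> R" for x p q R
  proof -
    have "(\<bar>p\<bar> + \<bar>q\<bar> + 1) powr (\<gamma> - 1) \<le> (2 * R + 1) powr (\<gamma> - 1)"
      using that \<gamma> by (intro powr_mono2) auto
    then have "\<alpha>1 * (\<bar>p\<bar> + \<bar>q\<bar> + 1) powr (\<gamma> - 1) * \<bar>p - q\<bar> \<le> \<alpha>1 * (2 * R + 1) powr (\<gamma> - 1) * \<bar>p - q\<bar>"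
      using \<alpha> by (intro mult_right_mono mult_left_mono) auto
    then show ?thesis using H2[of x p q] by linarith
  qed
  then show "\<exists>L. \<forall>x p q. \<bar>p\<bar> \<le> R \<and> \<bar>q\<bar> \<le> R \<longrightarrow> \<bar>H x p - H x q\<bar> \<le> L * \<bar>p - q\<bar>" for R by blast
  show "H x q < max (H x p) (H x r)" if "p < q" "q < r" for x p q r
  proof -
    define t where "t = (r - q) / (r - p)"
    have "0 < t" "t < 1" using that unfolding t_def by auto
    moreover have "t * p + (1 - t) * r = q"
    proof -
      have "t * (r - p) = r - q" using that unfolding t_def by simp
      then show ?thesis by (simp add: algebra_simps)
    qed
    ultimately show ?thesis using H4[of p r t x] that by auto
  qed
  show "\<exists>M>0. \<forall>x p. M \<le> \<bar>p\<bar> \<longrightarrow> c < H x p" for c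
  proof -
    \<comment> \<open>With this \<open>B\<close>, \<open>\<alpha>0 * B - 1 / \<alpha>0\<close>
      equals \<open>\<bar>c\<bar> + 1\<close>; the threshold for the slope is its root
      \<open>B powr (1 / \<gamma>)\<close>.\<close>
    define B where "B = (\<bar>c\<bar> + 1 / \<alpha>0 + 1) / \<alpha>0"
    have B: "B > 0" "\<alpha>0 * B = \<bar>c\<bar> + 1 / \<alpha>0 + 1" using \<alpha> unfolding B_def by (auto intro!: divide_pos_pos add_nonneg_pos)
    have "c < H x p" if "B powr (1 / \<gamma>) \<le> \<bar>p\<bar>" for x p
    proof -
      have "B = (B powr (1 / \<gamma>)) powr \<gamma>" using B \<gamma> by (simp add: powr_powr)
      also have "\<dots> \<le> \<bar>p\<bar> powr \<gamma>" using that \<gamma> by (intro powr_mono2) auto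
      finally have "\<alpha>0 * B \<le> \<alpha>0 * \<bar>p\<bar> powr \<gamma>" using \<alpha> by simp
      then show ?thesis using H1[of p x] B by linarith
    qed
    then show ?thesis using B by (intro exI[of _ "B powr (1 / \<gamma>)"]) auto
  qed
  show "continuous_on UNIV (\<lambda>(x, p). H x p)"
    unfolding continuous_on_eq_continuous_at[OF open_UNIV]
  proof (rule ballI, clarify)
    fix x p
    \<comment> \<open>\<open>c\<close> is the Lipschitz constant in the slope on radius
      \<open>\<bar>p\<bar> + 1\<close>, and \<open>c'\<close> the one in the position at slope
      \<open>p\<close>. Splitting through \<open>H (fst w) p\<close> gives joint continuity.\<close>
    define c where "c = \<alpha>1 * (2 * (\<bar>p\<bar> + 1) + 1) powr (\<gamma> - 1)"
    define c' where "c' = \<alpha>1 * (\<bar>p\<bar> powr \<gamma> + 1)"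
    have "((\<lambda>w. c' * \<bar>fst w - x\<bar> + c * \<bar>snd w - p\<bar>) \<longlongrightarrow> c' * \<bar>fst (x, p) - x\<bar> + c * \<bar>snd (x, p) - p\<bar>) (at (x, p))"
      by (intro tendsto_intros)
    then have lim: "((\<lambda>w. c' * \<bar>fst w - x\<bar> + c * \<bar>snd w - p\<bar>) \<longlongrightarrow> 0) (at (x, p))" by simp
    have "((\<lambda>w. snd w) \<longlongrightarrow> snd (x, p)) (at (x, p))" by (intro tendsto_intros)
    then have "\<forall>\<^sub>F w in at (x, p). dist (snd w) p < 1" by (auto dest: tendstoD[of _ _ _ 1])
    then have "\<forall>\<^sub>F w in at (x, p). norm (H (fst w) (snd w) - H x p) \<le> c' * \<bar>fst w - x\<bar> + c * \<bar>snd w - p\<bar>"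
    proof eventually_elim
      case (elim w)
      have "\<bar>snd w\<bar> \<le> \<bar>p\<bar> + 1" using elim by (auto simp: dist_real_def)
      then have "\<bar>H (fst w) (snd w) - H (fst w) p\<bar> \<le> c * \<bar>snd w - p\<bar>" unfolding c_def by (intro H2') auto
      moreover have "\<bar>H (fst w) p - H x p\<bar> \<le> c' * \<bar>fst w - x\<bar>" unfolding c'_def by (rule H3)
      ultimately show ?case unfolding real_norm_def by linarith
    qed
    then have "((\<lambda>w. H (fst w) (snd w) - H x p) \<longlongrightarrow> 0) (at (x, p))"
      by (rule Lim_null_comparison[OF _ lim])
    then have "((\<lambda>w. H (fst w) (snd w)) \<longlongrightarrow> H x p) (at (x, p))" by (rule LIM_zero_cancel)
    then show "isCont (\<lambda>(x, p). H x p) (x, p)" unfolding isCont_def by (simp add: case_prod_unfold)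
  qed
qed

theorem mainTheorem12:
  fixes a :: "real \<Rightarrow> real" and H :: "real \<Rightarrow> real \<Rightarrow> real"
    and \<kappa> \<alpha>0 \<alpha>1 \<gamma> \<eta> lam :: real and u1 u2 v1 v2 :: "real \<Rightarrow> real"
  assumes "diff_coeff \<kappa> a"
    and "H_sqc \<alpha>0 \<alpha>1 \<gamma> \<eta> H" and "\<gamma> > 2" and "\<eta> > 0"
    and "lam > lambda0 a H"
    and "visc_sol a H lam u1" and "visc_sol a H lam u2"
    and "visc_sol a H (lambda0 a H) v1" and "visc_sol a H (lambda0 a H) v2"
  shows "(deriv_ge_ae u1 v1 \<and> deriv_ge_ae u2 v2 \<longrightarrow> (\<exists>c. \<forall>x. u1 x - u2 x = c))
       \<and> (deriv_ge_ae v1 u1 \<and> deriv_ge_ae v2 u2 \<longrightarrow> (\<exists>c. \<forall>x. u1 x - u2 x = c))"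
proof -
  interpret degenerate_equation a H "\<kappa>\<^sup>2" by (rule degenerate_equationI[OF assms(1-3)])
  interpret R: degenerate_equation "\<lambda>x. a (- x)" "\<lambda>x p. H (- x) (- p)" "\<kappa>\<^sup>2" by (rule reflected)
  show ?thesis
  proof (intro conjI impI)
    assume "deriv_ge_ae u1 v1 \<and> deriv_ge_ae u2 v2"
    then have "one_sided_deriv_ge u1 v1" "one_sided_deriv_ge u2 v2"
      using deriv_ge_ae_imp_one_sided assms(6-9) by blast+
    then show "\<exists>c. \<forall>x. u1 x - u2 x = c" by (rule difference_constant[OF assms(6-9,5)])
  next
    assume "deriv_ge_ae v1 u1 \<and> deriv_ge_ae v2 u2"
    then have "one_sided_deriv_ge v1 u1" "one_sided_deriv_ge v2 u2"
      using deriv_ge_ae_imp_one_sided assms(6-9) by blast+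
    \<comment> \<open>Reflection changes the sign of derivatives and so reverses the order between
      \<open>u1\<close>, \<open>u2\<close> and \<open>v1\<close>, \<open>v2\<close>.\<close>
    then have "\<exists>c. \<forall>x. u1 (- x) - u2 (- x) = c"
      by (intro R.difference_constant[OF assms(6-9)[THEN visc_sol_reflect] assms(5)] one_sided_deriv_ge_reflect)
    then show "\<exists>c. \<forall>x. u1 x - u2 x = c" by (metis minus_minus)
  qed
qed

end
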